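(* For every formula $\phi$, $\phi$ is a theorem of $\mathsf{MS^2IC}$ if and only if $\phi$ is valid in every zerodimensional upper continuous modal compingent algebra.
   Context: Language: propositional variables, $\top,\bot$, $\neg,\wedge,\vee,\to,\leftrightarrow$, a binary connective $\rightsquigarrow$ and a unary modality $\Box$; $\Diamond\phi:=\neg\Box\neg\phi$, $[\forall]\phi:=\top\rightsquigarrow\phi$. $\mathsf{MS^2IC}$: theorems are the least set containing all instances of classical tautologies and of (A1) $(\bot\rightsquigarrow\phi)\wedge(\phi\rightsquigarrow\top)$; (A2) $((\phi\vee\psi)\rightsquigarrow\chi)\leftrightarrow((\phi\rightsquigarrow\chi)\wedge(\psi\rightsquigarrow\chi))$; (A3) $(\phi\rightsquigarrow(\psi\wedge\chi))\leftrightarrow((\phi\rightsquigarrow\psi)\wedge(\phi\rightsquigarrow\chi))$; (A4) $(\phi\rightsquigarrow\psi)\to(\phi\to\psi)$; (A5) $(\phi\rightsquigarrow\psi)\leftrightarrow(\neg\psi\rightsquigarrow\neg\phi)$; (A8) $[\forall]\phi\to[\forall][\forall]\phi$; (A9) $\neg[\forall]\phi\to[\forall]\neg[\forall]\phi$; (A10) $(\phi\rightsquigarrow\psi)\leftrightarrow[\forall](\phi\rightsquigarrow\psi)$; (A11) $[\forall]\phi\to(\neg[\forall]\phi\rightsquigarrow\bot)$; (K) $\Box(\phi\to\psi)\to(\Box\phi\to\Box\psi)$; (Add) $(\phi\rightsquigarrow\psi)\to(\Box\phi\rightsquigarrow\Box\psi)$; closed under modus ponens, from $\phi$ infer $[\forall]\phi$,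 from $\phi$ infer $\Box\phi$. A contact algebra is $(B,\prec)$ with $B$ Boolean and $\prec$ satisfying: $0\prec0$, $1\prec1$; $a\prec b,a\prec c\Rightarrow a\prec b\wedge c$; $a\prec c,b\prec c\Rightarrow a\vee b\prec c$; $a\le b\prec c\le d\Rightarrow a\prec d$; $a\prec b\Rightarrow a\le b$; $a\prec b\Rightarrow\neg b\prec\neg a$; compingent if also $a\prec b$ implies $a\prec c\prec b$ for some $c$ and $a\ne0$ implies $b\prec a$ for some $b\neq0$; zerodimensional if $a\prec b$ implies there is $c$ with $c\prec c$ and $a\prec c\prec b$. A zerodimensional upper continuous modal compingent algebra is $(B,\prec,\Diamond)$ with $(B,\prec)$ zerodimensional compingent, $\Diamond$ de Vries additive ($\Diamond0=0$; $a_1\prec b_1,a_2\prec b_2$ imply $\Diamond(a_1\vee a_2)\prec\Diamond b_1\vee\Diamond b_2$) and upper continuous (for each $a$ the meet of $\{\Diamond b:a\prec b\}$ exists and equals $\Diamond a$). A valuation $v$ maps variables into $B$, extends with Boolean operations, $v(\phi\rightsquigarrow\psi)=1$ if $v(\phi)\prec v(\psi)$ else $0$, $v(\Box\phi)=\neg\Diamond\neg v(\phi)$; valid means $v(\phi)=1$ for all $v$.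
   Formalization: The calculus is given one extra rule, replacement of provable equivalents under ⇝ (from φ↔φ', ψ↔ψ' infer (φ⇝ψ)↔(φ'⇝ψ')); without it the valid formula ((p∧p)⇝q)→(p⇝q) is not derivable from the listed axioms and rules. *)

theory Defs
  imports Main
begin

section \<open>Syntax and the calculus\<close>

datatype fm =
    Var nat
  | Top
  | Bot
  | Neg fm
  | And fm fm
  | Or fm fm
  | Imp fm fm
  | Iff fm fm
  | Strict fm fm
  | Box fm

notation Top (\<open>\<^bold>\<top>\<close>)
  and Bot (\<open>\<^bold>\<bottom>\<close>)
  and Neg (\<open>\<^bold>\<not>_\<close> [90] 90)
  and And (infixr \<open>\<^bold>\<and>\<close> 75)
  and Or (infixr \<open>\<^bold>\<or>\<close> 70)
  and Imp (infixr \<open>\<^bold>\<longrightarrow>\<close> 60)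
  and Iff (infixr \<open>\<^bold>\<longleftrightarrow>\<close> 55)
  and Strict (infix \<open>\<leadsto>\<close> 65)
  and Box (\<open>\<box>_\<close> [90] 90)

abbreviation Univ :: "fm \<Rightarrow> fm" (\<open>[\<^bold>\<forall>]_\<close> [90] 90)
  where "[\<^bold>\<forall>]\<phi> \<equiv> \<^bold>\<top> \<leadsto> \<phi>"

datatype pfm =
    PVar nat
  | PTop
  | PBot
  | PNeg pfm
  | PAnd pfm pfm
  | POr pfm pfm
  | PImp pfm pfm
  | PIff pfm pfm

primrec ptrue :: "(nat \<Rightarrow> bool) \<Rightarrow> pfm \<Rightarrow> bool" where
  "ptrue t (PVar n) \<longleftrightarrow> t n"
| "ptrue t PTop \<longleftrightarrow> True"
| "ptrue t PBot \<longleftrightarrow> False"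
| "ptrue t (PNeg p) \<longleftrightarrow> \<not> ptrue t p"
| "ptrue t (PAnd p q) \<longleftrightarrow> ptrue t p \<and> ptrue t q"
| "ptrue t (POr p q) \<longleftrightarrow> ptrue t p \<or> ptrue t q"
| "ptrue t (PImp p q) \<longleftrightarrow> (ptrue t p \<longrightarrow> ptrue t q)"
| "ptrue t (PIff p q) \<longleftrightarrow> (ptrue t p \<longleftrightarrow> ptrue t q)"

definition tautology :: "pfm \<Rightarrow> bool"
  where "tautology p \<longleftrightarrow> (\<forall>t. ptrue t p)"

primrec inst :: "(nat \<Rightarrow> fm) \<Rightarrow> pfm \<Rightarrow> fm" where
  "inst \<sigma> (PVar n) = \<sigma> n"
| "inst \<sigma> PTop = \<^bold>\<top>"
| "inst \<sigma> PBot = \<^bold>\<bottom>"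
| "inst \<sigma> (PNeg p) = \<^bold>\<not> inst \<sigma> p"
| "inst \<sigma> (PAnd p q) = inst \<sigma> p \<^bold>\<and> inst \<sigma> q"
| "inst \<sigma> (POr p q) = inst \<sigma> p \<^bold>\<or> inst \<sigma> q"
| "inst \<sigma> (PImp p q) = (inst \<sigma> p \<^bold>\<longrightarrow> inst \<sigma> q)"
| "inst \<sigma> (PIff p q) = (inst \<sigma> p \<^bold>\<longleftrightarrow> inst \<sigma> q)"

text \<open>
  The rule \<open>RE\<close> (replacement of provable equivalents under \<open>\<leadsto>\<close>) is the usual convention that
  makes the Lindenbaum algebra well defined. It is not derivable from the remaining axioms and
  rules: without it \<open>((p \<^bold>\<and> p) \<leadsto> q) \<^bold>\<longrightarrow> (p \<leadsto> q)\<close> is not a theorem, although it is valid in every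
  contact algebra. Replacement under \<open>\<box>\<close> is derivable from \<open>K\<close> and \<open>Nec\<close>.
\<close>

inductive MS2IC :: "fm \<Rightarrow> bool" where
  Taut: "tautology p \<Longrightarrow> MS2IC (inst \<sigma> p)"
| A1: "MS2IC ((\<^bold>\<bottom> \<leadsto> \<phi>) \<^bold>\<and> (\<phi> \<leadsto> \<^bold>\<top>))"
| A2: "MS2IC (((\<phi> \<^bold>\<or> \<psi>) \<leadsto> \<chi>) \<^bold>\<longleftrightarrow> ((\<phi> \<leadsto> \<chi>) \<^bold>\<and> (\<psi> \<leadsto> \<chi>)))"
| A3: "MS2IC ((\<phi> \<leadsto> (\<psi> \<^bold>\<and> \<chi>)) \<^bold>\<longleftrightarrow> ((\<phi> \<leadsto> \<psi>) \<^bold>\<and> (\<phi> \<leadsto> \<chi>)))"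
| A4: "MS2IC ((\<phi> \<leadsto> \<psi>) \<^bold>\<longrightarrow> (\<phi> \<^bold>\<longrightarrow> \<psi>))"
| A5: "MS2IC ((\<phi> \<leadsto> \<psi>) \<^bold>\<longleftrightarrow> ((\<^bold>\<not> \<psi>) \<leadsto> (\<^bold>\<not> \<phi>)))"
| A8: "MS2IC ([\<^bold>\<forall>]\<phi> \<^bold>\<longrightarrow> [\<^bold>\<forall>]([\<^bold>\<forall>]\<phi>))"
| A9: "MS2IC (\<^bold>\<not>([\<^bold>\<forall>]\<phi>) \<^bold>\<longrightarrow> [\<^bold>\<forall>](\<^bold>\<not>([\<^bold>\<forall>]\<phi>)))"
| A10: "MS2IC ((\<phi> \<leadsto> \<psi>) \<^bold>\<longleftrightarrow> [\<^bold>\<forall>](\<phi> \<leadsto> \<psi>))"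
| A11: "MS2IC ([\<^bold>\<forall>]\<phi> \<^bold>\<longrightarrow> ((\<^bold>\<not>([\<^bold>\<forall>]\<phi>)) \<leadsto> \<^bold>\<bottom>))"
| K: "MS2IC (\<box>(\<phi> \<^bold>\<longrightarrow> \<psi>) \<^bold>\<longrightarrow> (\<box>\<phi> \<^bold>\<longrightarrow> \<box>\<psi>))"
| Add: "MS2IC ((\<phi> \<leadsto> \<psi>) \<^bold>\<longrightarrow> (\<box>\<phi> \<leadsto> \<box>\<psi>))"
| MP: "MS2IC (\<phi> \<^bold>\<longrightarrow> \<psi>) \<Longrightarrow> MS2IC \<phi> \<Longrightarrow> MS2IC \<psi>"
| NecU: "MS2IC \<phi> \<Longrightarrow> MS2IC ([\<^bold>\<forall>]\<phi>)"
| Nec: "MS2IC \<phi> \<Longrightarrow> MS2IC (\<box>\<phi>)"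
| RE: "MS2IC (\<phi> \<^bold>\<longleftrightarrow> \<phi>') \<Longrightarrow> MS2IC (\<psi> \<^bold>\<longleftrightarrow> \<psi>') \<Longrightarrow> MS2IC ((\<phi> \<leadsto> \<psi>) \<^bold>\<longleftrightarrow> (\<phi>' \<leadsto> \<psi>'))"

section \<open>Algebras\<close>

text \<open>
  Algebras live on an explicit carrier set inside a type, so that one statement can quantify over
  all algebras of that type. Every condition below is first order in a countable signature, so by
  downward Loewenheim-Skolem any infinite type hosts a countermodel to each refutable formula;
  soundness is not affected by the choice of type. The one-element Boolean algebra is admitted.
\<close>

record 'a ba =
  carrier :: "'a set"
  meet :: "'a \<Rightarrow> 'a \<Rightarrow> 'a" (infixl \<open>\<sqinter>\<index>\<close> 70)
  join :: "'a \<Rightarrow> 'a \<Rightarrow> 'a" (infixl \<open>\<squnion>\<index>\<close> 65)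
  compl :: "'a \<Rightarrow> 'a" (\<open>\<sim>\<index> _\<close> [81] 80)
  zero :: 'a (\<open>\<zero>\<index>\<close>)
  one :: 'a (\<open>\<one>\<index>\<close>)

record 'a contact = "'a ba" +
  prec :: "'a \<Rightarrow> 'a \<Rightarrow> bool" (infix \<open>\<prec>\<index>\<close> 50)

record 'a modal_contact = "'a contact" +
  dia :: "'a \<Rightarrow> 'a" (\<open>\<diamond>\<index> _\<close> [81] 80)

definition le :: "('a, 'm) ba_scheme \<Rightarrow> 'a \<Rightarrow> 'a \<Rightarrow> bool" (infix \<open>\<sqsubseteq>\<index>\<close> 50)
  where "a \<sqsubseteq>\<^bsub>B\<^esub> b \<longleftrightarrow> a \<sqinter>\<^bsub>B\<^esub> b = a"

definition is_inf :: "('a, 'm) ba_scheme \<Rightarrow> 'a set \<Rightarrow> 'a \<Rightarrow> bool"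
  where "is_inf B S m \<longleftrightarrow> m \<in> carrier B \<and> (\<forall>s\<in>S. m \<sqsubseteq>\<^bsub>B\<^esub> s) \<and>
    (\<forall>l\<in>carrier B. (\<forall>s\<in>S. l \<sqsubseteq>\<^bsub>B\<^esub> s) \<longrightarrow> l \<sqsubseteq>\<^bsub>B\<^esub> m)"

locale boolean_alg =
  fixes B :: "('a, 'm) ba_scheme" (structure)
  assumes meet_closed: "\<lbrakk>a \<in> carrier B; b \<in> carrier B\<rbrakk> \<Longrightarrow> a \<sqinter> b \<in> carrier B"
    and join_closed: "\<lbrakk>a \<in> carrier B; b \<in> carrier B\<rbrakk> \<Longrightarrow> a \<squnion> b \<in> carrier B"
    and compl_closed: "a \<in> carrier B \<Longrightarrow> \<sim> a \<in> carrier B"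
    and zero_closed: "\<zero> \<in> carrier B"
    and one_closed: "\<one> \<in> carrier B"
    and meet_assoc: "\<lbrakk>a \<in> carrier B; b \<in> carrier B; c \<in> carrier B\<rbrakk> \<Longrightarrow> (a \<sqinter> b) \<sqinter> c = a \<sqinter> (b \<sqinter> c)"
    and join_assoc: "\<lbrakk>a \<in> carrier B; b \<in> carrier B; c \<in> carrier B\<rbrakk> \<Longrightarrow> (a \<squnion> b) \<squnion> c = a \<squnion> (b \<squnion> c)"
    and meet_comm: "\<lbrakk>a \<in> carrier B; b \<in> carrier B\<rbrakk> \<Longrightarrow> a \<sqinter> b = b \<sqinter> a"
    and join_comm: "\<lbrakk>a \<in> carrier B; b \<in> carrier B\<rbrakk> \<Longrightarrow> a \<squnion> b = b \<squnion> a"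
    and meet_join_distrib:
      "\<lbrakk>a \<in> carrier B; b \<in> carrier B; c \<in> carrier B\<rbrakk> \<Longrightarrow> a \<sqinter> (b \<squnion> c) = (a \<sqinter> b) \<squnion> (a \<sqinter> c)"
    and join_meet_distrib:
      "\<lbrakk>a \<in> carrier B; b \<in> carrier B; c \<in> carrier B\<rbrakk> \<Longrightarrow> a \<squnion> (b \<sqinter> c) = (a \<squnion> b) \<sqinter> (a \<squnion> c)"
    and meet_one: "a \<in> carrier B \<Longrightarrow> a \<sqinter> \<one> = a"
    and join_zero: "a \<in> carrier B \<Longrightarrow> a \<squnion> \<zero> = a"
    and meet_compl: "a \<in> carrier B \<Longrightarrow> a \<sqinter> \<sim> a = \<zero>"
    and join_compl: "a \<in> carrier B \<Longrightarrow> a \<squnion> \<sim> a = \<one>"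

locale contact_algebra = boolean_alg B for B :: "('a, 'm) contact_scheme" (structure) +
  assumes prec_zero: "\<zero> \<prec> \<zero>"
    and prec_one: "\<one> \<prec> \<one>"
    and prec_meet:
      "\<lbrakk>a \<in> carrier B; b \<in> carrier B; c \<in> carrier B; a \<prec> b; a \<prec> c\<rbrakk> \<Longrightarrow> a \<prec> b \<sqinter> c"
    and prec_join:
      "\<lbrakk>a \<in> carrier B; b \<in> carrier B; c \<in> carrier B; a \<prec> c; b \<prec> c\<rbrakk> \<Longrightarrow> a \<squnion> b \<prec> c"
    and prec_mono:
      "\<lbrakk>a \<in> carrier B; b \<in> carrier B; c \<in> carrier B; d \<in> carrier B; a \<sqsubseteq> b; b \<prec> c; c \<sqsubseteq> d\<rbrakk>
        \<Longrightarrow> a \<prec> d"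
    and prec_le: "\<lbrakk>a \<in> carrier B; b \<in> carrier B; a \<prec> b\<rbrakk> \<Longrightarrow> a \<sqsubseteq> b"
    and prec_compl: "\<lbrakk>a \<in> carrier B; b \<in> carrier B; a \<prec> b\<rbrakk> \<Longrightarrow> \<sim> b \<prec> \<sim> a"

locale compingent_algebra = contact_algebra +
  assumes prec_interpolate:
      "\<lbrakk>a \<in> carrier B; b \<in> carrier B; a \<prec> b\<rbrakk> \<Longrightarrow> \<exists>c\<in>carrier B. a \<prec> c \<and> c \<prec> b"
    and prec_nonzero: "\<lbrakk>a \<in> carrier B; a \<noteq> \<zero>\<rbrakk> \<Longrightarrow> \<exists>b\<in>carrier B. b \<noteq> \<zero> \<and> b \<prec> a"

locale zerodim_compingent_algebra = compingent_algebra +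
  assumes zerodimensional:
    "\<lbrakk>a \<in> carrier B; b \<in> carrier B; a \<prec> b\<rbrakk> \<Longrightarrow> \<exists>c\<in>carrier B. c \<prec> c \<and> a \<prec> c \<and> c \<prec> b"

locale zerodim_uc_modal_compingent_algebra =
  zerodim_compingent_algebra B for B :: "('a, 'm) modal_contact_scheme" (structure) +
  assumes dia_closed: "a \<in> carrier B \<Longrightarrow> \<diamond> a \<in> carrier B"
    and dia_zero: "\<diamond> \<zero> = \<zero>"
    and de_Vries_additive:
      "\<lbrakk>a\<^sub>1 \<in> carrier B; a\<^sub>2 \<in> carrier B; b\<^sub>1 \<in> carrier B; b\<^sub>2 \<in> carrier B; a\<^sub>1 \<prec> b\<^sub>1; a\<^sub>2 \<prec> b\<^sub>2\<rbrakk>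
        \<Longrightarrow> \<diamond> (a\<^sub>1 \<squnion> a\<^sub>2) \<prec> (\<diamond> b\<^sub>1) \<squnion> (\<diamond> b\<^sub>2)"
    and upper_continuous:
      "a \<in> carrier B \<Longrightarrow> is_inf B {\<diamond> b | b. b \<in> carrier B \<and> a \<prec> b} (\<diamond> a)"

section \<open>Semantics\<close>

primrec ext :: "('a, 'm) modal_contact_scheme \<Rightarrow> (nat \<Rightarrow> 'a) \<Rightarrow> fm \<Rightarrow> 'a" where
  "ext B v (Var n) = v n"
| "ext B v \<^bold>\<top> = \<one>\<^bsub>B\<^esub>"
| "ext B v \<^bold>\<bottom> = \<zero>\<^bsub>B\<^esub>"
| "ext B v (\<^bold>\<not> \<phi>) = \<sim>\<^bsub>B\<^esub> ext B v \<phi>"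
| "ext B v (\<phi> \<^bold>\<and> \<psi>) = ext B v \<phi> \<sqinter>\<^bsub>B\<^esub> ext B v \<psi>"
| "ext B v (\<phi> \<^bold>\<or> \<psi>) = ext B v \<phi> \<squnion>\<^bsub>B\<^esub> ext B v \<psi>"
| "ext B v (\<phi> \<^bold>\<longrightarrow> \<psi>) = (\<sim>\<^bsub>B\<^esub> ext B v \<phi>) \<squnion>\<^bsub>B\<^esub> ext B v \<psi>"
| "ext B v (\<phi> \<^bold>\<longleftrightarrow> \<psi>) =
    ((\<sim>\<^bsub>B\<^esub> ext B v \<phi>) \<squnion>\<^bsub>B\<^esub> ext B v \<psi>) \<sqinter>\<^bsub>B\<^esub> ((\<sim>\<^bsub>B\<^esub> ext B v \<psi>) \<squnion>\<^bsub>B\<^esub> ext B v \<phi>)"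
| "ext B v (\<phi> \<leadsto> \<psi>) = (if ext B v \<phi> \<prec>\<^bsub>B\<^esub> ext B v \<psi> then \<one>\<^bsub>B\<^esub> else \<zero>\<^bsub>B\<^esub>)"
| "ext B v (\<box>\<phi>) = \<sim>\<^bsub>B\<^esub> (\<diamond>\<^bsub>B\<^esub> (\<sim>\<^bsub>B\<^esub> ext B v \<phi>))"

definition valid_in :: "('a, 'm) modal_contact_scheme \<Rightarrow> fm \<Rightarrow> bool"
  where "valid_in B \<phi> \<longleftrightarrow> (\<forall>v. (\<forall>n. v n \<in> carrier B) \<longrightarrow> ext B v \<phi> = \<one>\<^bsub>B\<^esub>)"

end

theory Submission
  imports Defs "HOL-Library.Countable_Set"
begin

text \<open>
  For completeness, a maximal theory \<open>\<Gamma>\<close> omitting \<open>\<phi>\<close> yields a canonical frame: the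
  maximal theories agreeing with \<open>\<Gamma>\<close> on \<open>\<leadsto>\<close>, with a reflexive symmetric relation \<open>R\<close> that represents
  \<open>\<leadsto>\<close> and a relation \<open>S\<close> that represents \<open>\<box>\<close>. By the axiom \<open>Add\<close>, if \<open>x R x'\<close> and \<open>x S y\<close>, then there
  is \<open>y'\<close> with \<open>x' S y'\<close> and \<open>y R y'\<close>.

  Replace every edge \<open>x R y\<close> by points \<open>(x, y, n)\<close> for all natural \<open>n\<close>, and call a set of points
  clopen if from some level on its membership depends neither on \<open>n\<close> nor on the orientation of
  the edge. Put \<open>a \<prec> b\<close> if a clopen set lies between \<open>a\<close> and \<open>b\<close>, and let \<open>\<diamond>\<close> be the preimage under
  \<open>S\<close> acting on both endpoints and preserving the level. Sets of bounded level are clopen, which makes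
  this algebra compingent; adding all high levels to a set makes it clopen without changing \<open>\<diamond>\<close> on
  the low levels, which makes \<open>\<diamond>\<close> upper continuous. Sending \<open>\<psi>\<close> to the points \<open>(x, y, n)\<close> with
  \<open>\<psi> \<in> x\<close> represents the canonical frame. The countable subalgebra generated by the variables, the
  levels, \<open>\<diamond>\<close> and edge reversal has all required properties and embeds into any infinite type.
\<close>

section \<open>Two-valued homomorphisms\<close>

context boolean_alg
begin

text \<open>Homomorphisms into the two-element algebra. They separate elements, so Boolean
  identities and inequalities can be checked by propositional reasoning on truth values.\<close>

definition bool_hom :: "('a \<Rightarrow> bool) \<Rightarrow> bool" where
  "bool_hom h \<longleftrightarrow> h \<one> \<and> \<not> h \<zero> \<and> (\<forall>a\<in>carrier B. h (\<sim> a) = (\<not> h a)) \<and>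
    (\<forall>a\<in>carrier B. \<forall>b\<in>carrier B. h (a \<sqinter> b) = (h a \<and> h b) \<and> h (a \<squnion> b) = (h a \<or> h b))"

definition filt :: "'a set \<Rightarrow> bool" where
  "filt F \<longleftrightarrow> F \<subseteq> carrier B \<and> \<one> \<in> F \<and> (\<forall>a\<in>F. \<forall>b\<in>F. a \<sqinter> b \<in> F) \<and>
    (\<forall>a\<in>F. \<forall>b\<in>carrier B. a \<sqsubseteq> b \<longrightarrow> b \<in> F)"

lemmas closed = meet_closed join_closed compl_closed zero_closed one_closed

section \<open>Derived Boolean laws and the order\<close>

lemma meet_idem:
  assumes "a \<in> carrier B"
  shows "a \<sqinter> a = a"
proof -
  have "a \<sqinter> a = (a \<sqinter> a) \<squnion> (a \<sqinter> \<sim> a)"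
    using assms by (simp add: meet_compl join_zero closed)
  also have "\<dots> = a \<sqinter> (a \<squnion> \<sim> a)"
    using assms by (simp add: meet_join_distrib closed)
  finally show ?thesis
    using assms by (simp add: join_compl meet_one)
qed

lemma join_idem:
  assumes "a \<in> carrier B"
  shows "a \<squnion> a = a"
proof -
  have "a \<squnion> a = (a \<squnion> a) \<sqinter> (a \<squnion> \<sim> a)"
    using assms by (simp add: join_compl meet_one closed)
  also have "\<dots> = a \<squnion> (a \<sqinter> \<sim> a)"
    using assms by (simp add: join_meet_distrib closed)
  finally show ?thesis
    using assms by (simp add: meet_compl join_zero)
qed

lemma meet_zero:
  assumes "a \<in> carrier B"
  shows "a \<sqinter> \<zero> = \<zero>"
proof -
  have "a \<sqinter> \<zero> = (a \<sqinter> a) \<sqinter> \<sim> a"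
    using assms by (subst meet_assoc) (auto simp: meet_compl closed)
  then show ?thesis
    using assms by (simp add: meet_idem meet_compl)
qed

lemma join_one:
  assumes "a \<in> carrier B"
  shows "a \<squnion> \<one> = \<one>"
proof -
  have "a \<squnion> \<one> = (a \<squnion> a) \<squnion> \<sim> a"
    using assms by (subst join_assoc) (auto simp: join_compl closed)
  then show ?thesis
    using assms by (simp add: join_idem join_compl)
qed

lemma zero_join: "a \<in> carrier B \<Longrightarrow> \<zero> \<squnion> a = a"
  by (metis join_comm join_zero closed(4))

lemma one_join: "a \<in> carrier B \<Longrightarrow> \<one> \<squnion> a = \<one>"
  by (metis join_comm join_one closed(5))

lemma zero_meet: "a \<in> carrier B \<Longrightarrow> \<zero> \<sqinter> a = \<zero>"
  by (metis meet_comm meet_zero closed(4))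

lemma meet_absorb:
  assumes "a \<in> carrier B" "b \<in> carrier B"
  shows "a \<sqinter> (a \<squnion> b) = a"
proof -
  have "a \<sqinter> (a \<squnion> b) = (a \<squnion> \<zero>) \<sqinter> (a \<squnion> b)"
    using assms by (simp add: join_zero)
  also have "\<dots> = a \<squnion> (\<zero> \<sqinter> b)"
    using assms by (simp add: join_meet_distrib closed)
  finally show ?thesis
    using assms by (simp add: zero_meet join_zero)
qed

lemma le_refl: "a \<in> carrier B \<Longrightarrow> a \<sqsubseteq> a"
  by (simp add: le_def meet_idem)

lemma le_trans:
  "\<lbrakk>a \<in> carrier B; b \<in> carrier B; c \<in> carrier B; a \<sqsubseteq> b; b \<sqsubseteq> c\<rbrakk> \<Longrightarrow> a \<sqsubseteq> c"
  unfolding le_def by (metis meet_assoc)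

lemma meet_le1: "\<lbrakk>a \<in> carrier B; b \<in> carrier B\<rbrakk> \<Longrightarrow> a \<sqinter> b \<sqsubseteq> a"
  unfolding le_def by (metis meet_assoc meet_comm meet_idem)

lemma meet_le2: "\<lbrakk>a \<in> carrier B; b \<in> carrier B\<rbrakk> \<Longrightarrow> a \<sqinter> b \<sqsubseteq> b"
  by (metis meet_comm meet_le1)

lemma le_meetI:
  "\<lbrakk>a \<in> carrier B; b \<in> carrier B; c \<in> carrier B; c \<sqsubseteq> a; c \<sqsubseteq> b\<rbrakk> \<Longrightarrow> c \<sqsubseteq> a \<sqinter> b"
  unfolding le_def by (metis meet_assoc)

lemma meet_mono_left:
  assumes "a \<in> carrier B" "b \<in> carrier B" "c \<in> carrier B" "a \<sqsubseteq> b"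
  shows "a \<sqinter> c \<sqsubseteq> b \<sqinter> c"
proof (rule le_meetI)
  show "a \<sqinter> c \<sqsubseteq> b"
    using assms le_trans[of "a \<sqinter> c" a b] by (simp add: meet_le1 closed)
qed (use assms in \<open>auto simp: closed meet_le2\<close>)

lemma le_by_cases:
  assumes "a \<in> carrier B" "f \<in> carrier B" "c \<in> carrier B" "f \<sqinter> a \<sqsubseteq> c" "f \<sqinter> \<sim> a \<sqsubseteq> c"
  shows "f \<sqsubseteq> c"
proof -
  have "f = (f \<sqinter> a) \<squnion> (f \<sqinter> \<sim> a)"
    using assms by (metis closed(3) join_compl meet_join_distrib meet_one)
  also have "\<dots> = (c \<sqinter> (f \<sqinter> a)) \<squnion> (c \<sqinter> (f \<sqinter> \<sim> a))"
    using assms unfolding le_def by (metis closed(1,3) meet_comm)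
  also have "\<dots> = c \<sqinter> f"
    using assms by (metis closed(1,3) join_compl meet_join_distrib meet_one)
  finally show ?thesis
    using assms unfolding le_def by (metis meet_comm)
qed

lemma antisym_le: "\<lbrakk>a \<in> carrier B; b \<in> carrier B; a \<sqsubseteq> b; b \<sqsubseteq> a\<rbrakk> \<Longrightarrow> a = b"
  unfolding le_def by (metis meet_comm)

text \<open>\<open>F'\<close> is the filter generated by \<open>F\<close> and \<open>a\<close>; it
  is what maximality of a filter is tested against.\<close>

lemma filt_extend:
  assumes F: "filt F" and a: "a \<in> carrier B"
  defines "F' \<equiv> {z \<in> carrier B. \<exists>f\<in>F. f \<sqinter> a \<sqsubseteq> z}"
  shows "filt F'" "F \<subseteq> F'" "a \<in> F'"
proof -
  have sub: "f \<in> carrier B" if "f \<in> F" for f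
    using F that by (auto simp: filt_def)
  have one: "\<one> \<in> F"
    using F by (simp add: filt_def)
  show "F \<subseteq> F'"
    using sub a meet_le1 by (auto simp: F'_def)
  show "a \<in> F'"
    using sub a one meet_le2 unfolding F'_def by blast
  have "b \<sqinter> c \<in> F'" if "b \<in> F'" "c \<in> F'" for b c
  proof -
    obtain f g where fg: "f \<in> F" "g \<in> F" "f \<sqinter> a \<sqsubseteq> b" "g \<sqinter> a \<sqsubseteq> c"
      using \<open>b \<in> F'\<close> \<open>c \<in> F'\<close> by (auto simp: F'_def)
    have car: "b \<in> carrier B" "c \<in> carrier B" "f \<in> carrier B" "g \<in> carrier B"
      using that fg sub by (auto simp: F'_def)
    have *: "(f \<sqinter> g) \<sqinter> a \<sqsubseteq> f \<sqinter> a" "(f \<sqinter> g) \<sqinter> a \<sqsubseteq> g \<sqinter> a"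
      using a car by (simp_all add: meet_mono_left meet_le1 meet_le2 closed)
    have "(f \<sqinter> g) \<sqinter> a \<sqsubseteq> b" "(f \<sqinter> g) \<sqinter> a \<sqsubseteq> c"
      using le_trans[OF _ _ _ *(1) fg(3)] le_trans[OF _ _ _ *(2) fg(4)] car a
      by (simp_all add: closed)
    then have "(f \<sqinter> g) \<sqinter> a \<sqsubseteq> b \<sqinter> c"
      using car a by (simp add: le_meetI closed)
    moreover have "f \<sqinter> g \<in> F"
      using F fg by (auto simp: filt_def)
    ultimately show ?thesis
      using car closed by (auto simp: F'_def)
  qed
  moreover have "c \<in> F'" if "b \<in> F'" "c \<in> carrier B" "b \<sqsubseteq> c" for b c
  proof -
    obtain f where f: "f \<in> F" "f \<sqinter> a \<sqsubseteq> b" "b \<in> carrier B"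
      using \<open>b \<in> F'\<close> by (auto simp: F'_def)
    then have "f \<sqinter> a \<sqsubseteq> c"
      using le_trans[of "f \<sqinter> a" b c] that a sub by (simp add: closed)
    then show ?thesis
      using f that by (auto simp: F'_def)
  qed
  moreover have "\<one> \<in> F'"
    using \<open>F \<subseteq> F'\<close> one by auto
  ultimately show "filt F'"
    by (auto simp: filt_def F'_def)
qed

text \<open>This is the prime filter theorem. Zorn's lemma gives a filter that is maximal among
  those containing \<open>a\<close> and omitting \<open>b\<close>; it decides every element, and
  membership in it is the homomorphism.\<close>

lemma bool_hom_separates:
  assumes ab: "a \<in> carrier B" "b \<in> carrier B" and nle: "\<not> a \<sqsubseteq> b"
  obtains h where "bool_hom h" "h a" "\<not> h b"
proof -
  define Q where "Q = {F. filt F \<and> a \<in> F \<and> b \<notin> F}"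
  define F0 where "F0 = {z \<in> carrier B. a \<sqsubseteq> z}"
  have "a \<sqsubseteq> \<one>"
    using ab by (simp add: le_def meet_one)
  \<comment> \<open>The principal filter of \<open>a\<close> starts the Zorn argument.\<close>
  then have "F0 \<in> Q"
    using ab nle by (auto simp: Q_def F0_def filt_def le_refl le_meetI closed intro: le_trans[of a])
  have "\<exists>F\<in>Q. \<forall>G\<in>Q. F \<subseteq> G \<longrightarrow> G = F"
  proof (rule subset_Zorn_nonempty)
    show "Q \<noteq> {}"
      using \<open>F0 \<in> Q\<close> by auto
    fix C assume C: "C \<noteq> {}" "subset.chain Q C"
    then have CQ: "\<And>F. F \<in> C \<Longrightarrow> filt F \<and> a \<in> F \<and> b \<notin> F"
      by (auto simp: subset.chain_def Q_def)
    have lin: "F \<subseteq> G \<or> G \<subseteq> F" if "F \<in> C" "G \<in> C" for F G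
      using C that by (auto simp: subset.chain_def)
    have "c \<sqinter> d \<in> \<Union>C" if cd: "c \<in> \<Union>C" "d \<in> \<Union>C" for c d
    proof -
      obtain F G where FG: "F \<in> C" "G \<in> C" "c \<in> F" "d \<in> G"
        using cd by auto
      show ?thesis
        using lin[OF FG(1,2)]
      proof
        assume "F \<subseteq> G"
        then have "c \<sqinter> d \<in> G"
          using CQ[OF FG(2)] FG unfolding filt_def by auto
        then show ?thesis
          using FG by auto
      next
        assume "G \<subseteq> F"
        then have "c \<sqinter> d \<in> F"
          using CQ[OF FG(1)] FG unfolding filt_def by auto
        then show ?thesis
          using FG by auto
      qed
    qed
    moreover have "\<Union>C \<subseteq> carrier B" "\<one> \<in> \<Union>C" "a \<in> \<Union>C" "b \<notin> \<Union>C"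
      using CQ C(1) unfolding filt_def by blast+
    moreover have "d \<in> \<Union>C" if "c \<in> \<Union>C" "d \<in> carrier B" "c \<sqsubseteq> d" for c d
      using CQ that unfolding filt_def by blast
    ultimately show "\<Union>C \<in> Q"
      by (auto simp: Q_def filt_def)
  qed
  then obtain F where F: "filt F" "a \<in> F" "b \<notin> F"
    and maxF: "\<And>G. \<lbrakk>filt G; a \<in> G; b \<notin> G; F \<subseteq> G\<rbrakk> \<Longrightarrow> G = F"
    by (auto simp: Q_def)
  have sub: "f \<in> carrier B" if "f \<in> F" for f
    using F that by (auto simp: filt_def)
  have meetF: "c \<sqinter> d \<in> F" if "c \<in> F" "d \<in> F" for c d
    using F that by (auto simp: filt_def)
  have upF: "d \<in> F" if "c \<in> F" "d \<in> carrier B" "c \<sqsubseteq> d" for c d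
    using F that by (auto simp: filt_def)
  have oneF: "\<one> \<in> F"
    using F by (auto simp: filt_def)
  have zeroF: "\<zero> \<notin> F"
    using upF[of \<zero> b] F ab by (auto simp: le_def meet_comm meet_zero closed)
  \<comment> \<open>By maximality, the filter generated by \<open>F\<close> and an element outside
    it can no longer omit \<open>b\<close>.\<close>
  have ext: "\<exists>f\<in>F. f \<sqinter> c \<sqsubseteq> b" if c: "c \<in> carrier B" "c \<notin> F" for c
    using filt_extend[OF F(1) c(1)] maxF[of "{z \<in> carrier B. \<exists>f\<in>F. f \<sqinter> c \<sqsubseteq> z}"] F(2) c(2) ab(2)
    by blast
  \<comment> \<open>If \<open>F\<close> omitted \<open>c\<close> and its complement, both extensions
    would reach \<open>b\<close>; splitting \<open>f \<sqinter> g\<close> along \<open>c\<close>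
    then puts \<open>b\<close> into \<open>F\<close>.\<close>
  have total: "c \<in> F \<or> \<sim> c \<in> F" if c: "c \<in> carrier B" for c
  proof (rule ccontr)
    assume "\<not> ?thesis"
    then obtain f g where fg: "f \<in> F" "f \<sqinter> c \<sqsubseteq> b" "g \<in> F" "g \<sqinter> \<sim> c \<sqsubseteq> b"
      using ext c closed by metis
    have car: "f \<in> carrier B" "g \<in> carrier B"
      using fg sub by auto
    have *: "(f \<sqinter> g) \<sqinter> c \<sqsubseteq> f \<sqinter> c" "(f \<sqinter> g) \<sqinter> \<sim> c \<sqsubseteq> g \<sqinter> \<sim> c"
      using c car by (simp_all add: meet_mono_left meet_le1 meet_le2 closed)
    have "(f \<sqinter> g) \<sqinter> c \<sqsubseteq> b" "(f \<sqinter> g) \<sqinter> \<sim> c \<sqsubseteq> b"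
      using le_trans[OF _ _ _ *(1) fg(2)] le_trans[OF _ _ _ *(2) fg(4)] c car ab
      by (simp_all add: closed)
    then have "f \<sqinter> g \<sqsubseteq> b"
      using le_by_cases[of c "f \<sqinter> g" b] c car ab by (simp add: closed)
    then show False
      using upF meetF fg ab F by blast
  qed
  have neg: "\<sim> c \<in> F \<longleftrightarrow> c \<notin> F" if c: "c \<in> carrier B" for c
    using total[OF c] meetF[of c "\<sim> c"] zeroF c by (auto simp: meet_compl)
  have meet: "c \<sqinter> d \<in> F \<longleftrightarrow> c \<in> F \<and> d \<in> F" if "c \<in> carrier B" "d \<in> carrier B" for c d
    using that meetF upF meet_le1 meet_le2 closed by metis
  have join: "c \<squnion> d \<in> F \<longleftrightarrow> c \<in> F \<or> d \<in> F" if cd: "c \<in> carrier B" "d \<in> carrier B" for c d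
  proof
    assume "c \<in> F \<or> d \<in> F"
    then show "c \<squnion> d \<in> F"
      using upF[of c "c \<squnion> d"] upF[of d "c \<squnion> d"] meet_absorb[of d c] join_comm[of d c] cd
      by (auto simp: le_def meet_absorb closed)
  next
    assume j: "c \<squnion> d \<in> F"
    \<comment> \<open>Below the complement of \<open>c\<close> the join shrinks to \<open>d\<close>,
      so an omitted \<open>c\<close> forces \<open>d\<close> into \<open>F\<close>.\<close>
    have "\<sim> c \<sqinter> (c \<squnion> d) = (c \<sqinter> \<sim> c) \<squnion> (\<sim> c \<sqinter> d)"
      using cd by (simp add: meet_join_distrib closed meet_comm[of c])
    also have "\<dots> = \<sim> c \<sqinter> d"
      using cd by (simp add: meet_compl zero_join closed)
    finally have "\<sim> c \<sqinter> (c \<squnion> d) = \<sim> c \<sqinter> d" .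
    then show "c \<in> F \<or> d \<in> F"
      using j cd meet[of "\<sim> c" "c \<squnion> d"] meet[of "\<sim> c" d] neg closed by auto
  qed
  have "bool_hom (\<lambda>x. x \<in> F)"
    by (simp add: bool_hom_def oneF zeroF neg meet join)
  then show ?thesis
    using that F by blast
qed

section \<open>Boolean facts checked on two-valued homomorphisms\<close>

lemma le_homI:
  assumes "a \<in> carrier B" "b \<in> carrier B" "\<And>h. bool_hom h \<Longrightarrow> h a \<Longrightarrow> h b"
  shows "a \<sqsubseteq> b"
  using bool_hom_separates[OF assms(1,2)] assms(3) by metis

lemma le_homD:
  assumes "a \<sqsubseteq> b" "a \<in> carrier B" "b \<in> carrier B" "bool_hom h" "h a"
  shows "h b"
  using assms unfolding le_def bool_hom_def by metis

lemma le_hom_iff: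
  assumes "a \<in> carrier B" "b \<in> carrier B"
  shows "a \<sqsubseteq> b \<longleftrightarrow> (\<forall>h. bool_hom h \<longrightarrow> h a \<longrightarrow> h b)"
  using assms le_homI le_homD by blast

lemma eq_homI:
  assumes "a \<in> carrier B" "b \<in> carrier B" "\<And>h. bool_hom h \<Longrightarrow> h a \<longleftrightarrow> h b"
  shows "a = b"
  using assms by (intro antisym_le le_homI) auto

lemma hom_simps:
  assumes "bool_hom h"
  shows "h \<one>" "\<not> h \<zero>" "a \<in> carrier B \<Longrightarrow> h (\<sim> a) \<longleftrightarrow> \<not> h a"
    "\<lbrakk>a \<in> carrier B; b \<in> carrier B\<rbrakk> \<Longrightarrow> h (a \<sqinter> b) \<longleftrightarrow> h a \<and> h b"
    "\<lbrakk>a \<in> carrier B; b \<in> carrier B\<rbrakk> \<Longrightarrow> h (a \<squnion> b) \<longleftrightarrow> h a \<or> h b"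
  using assms by (auto simp: bool_hom_def)

lemma imp_eq_one_iff:
  assumes "a \<in> carrier B" "b \<in> carrier B"
  shows "(\<sim> a) \<squnion> b = \<one> \<longleftrightarrow> a \<sqsubseteq> b"
proof
  assume eq: "(\<sim> a) \<squnion> b = \<one>"
  show "a \<sqsubseteq> b"
  proof (rule le_homI)
    fix h assume h: "bool_hom h" "h a"
    have "h ((\<sim> a) \<squnion> b)"
      using eq h by (simp add: hom_simps)
    then show "h b"
      using h assms by (simp add: hom_simps closed)
  qed (use assms in auto)
next
  assume "a \<sqsubseteq> b"
  then show "(\<sim> a) \<squnion> b = \<one>"
    using assms by (intro eq_homI) (auto simp: hom_simps closed dest: le_homD)
qed

lemma iff_eq_one_iff:
  assumes "a \<in> carrier B" "b \<in> carrier B"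
  shows "((\<sim> a) \<squnion> b) \<sqinter> ((\<sim> b) \<squnion> a) = \<one> \<longleftrightarrow> a = b"
proof
  assume eq: "((\<sim> a) \<squnion> b) \<sqinter> ((\<sim> b) \<squnion> a) = \<one>"
  show "a = b"
  proof (rule eq_homI)
    fix h assume h: "bool_hom h"
    have "h (((\<sim> a) \<squnion> b) \<sqinter> ((\<sim> b) \<squnion> a))"
      using eq h by (simp add: hom_simps)
    then show "h a \<longleftrightarrow> h b"
      using h assms by (auto simp: hom_simps closed)
  qed (use assms in auto)
next
  assume "a = b"
  then show "((\<sim> a) \<squnion> b) \<sqinter> ((\<sim> b) \<squnion> a) = \<one>"
    using assms by (intro eq_homI) (auto simp: hom_simps closed)
qed

end

section \<open>Soundness\<close>

context zerodim_uc_modal_compingent_algebra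
begin

section \<open>Monotonicity and additivity of the diamond\<close>

lemma prec_trans_le:
  "\<lbrakk>a \<in> carrier B; b \<in> carrier B; c \<in> carrier B; a \<sqsubseteq> b; b \<prec> c\<rbrakk> \<Longrightarrow> a \<prec> c"
  using prec_mono[of a b c c] le_refl by auto

lemma le_diaI:
  assumes "a \<in> carrier B" "l \<in> carrier B" "\<And>b. \<lbrakk>b \<in> carrier B; a \<prec> b\<rbrakk> \<Longrightarrow> l \<sqsubseteq> \<diamond> b"
  shows "l \<sqsubseteq> \<diamond> a"
  using upper_continuous[OF assms(1)] assms(2,3) unfolding is_inf_def by blast

lemma dia_le:
  assumes "a \<in> carrier B" "b \<in> carrier B" "a \<prec> b"
  shows "\<diamond> a \<sqsubseteq> \<diamond> b"
  using upper_continuous[OF assms(1)] assms(2,3) unfolding is_inf_def by blast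

text \<open>Whatever \<open>b\<close> precedes, \<open>a\<close> precedes too, so the infimum
  defining \<open>\<diamond> b\<close> runs over fewer elements than the one defining
  \<open>\<diamond> a\<close>.\<close>

lemma dia_mono:
  assumes "a \<in> carrier B" "b \<in> carrier B" "a \<sqsubseteq> b"
  shows "\<diamond> a \<sqsubseteq> \<diamond> b"
  using assms prec_trans_le[of a b] by - (rule le_diaI, simp_all add: dia_le dia_closed)

text \<open>De Vries additivity bounds the left side by every \<open>\<diamond> c \<squnion> \<diamond> d\<close> with \<open>a \<prec> c\<close> and \<open>b \<prec> d\<close>;
  the two infima are taken one after the other, moving the other disjunct to the left.\<close>

lemma dia_join_le:
  assumes ab: "a \<in> carrier B" "b \<in> carrier B"
  shows "\<diamond> (a \<squnion> b) \<sqsubseteq> \<diamond> a \<squnion> \<diamond> b"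
proof -
  note cl = ab closed dia_closed
  have *: "\<diamond> (a \<squnion> b) \<sqinter> \<sim> (\<diamond> d) \<sqsubseteq> \<diamond> a" if d: "d \<in> carrier B" "b \<prec> d" for d
  proof (rule le_diaI)
    fix c assume c: "c \<in> carrier B" "a \<prec> c"
    have "\<diamond> (a \<squnion> b) \<sqsubseteq> \<diamond> c \<squnion> \<diamond> d"
      using c d cl by (intro prec_le de_Vries_additive) auto
    then show "\<diamond> (a \<squnion> b) \<sqinter> \<sim> (\<diamond> d) \<sqsubseteq> \<diamond> c"
      using c d by (auto simp: cl le_hom_iff hom_simps)
  qed (use cl d in auto)
  have "\<diamond> (a \<squnion> b) \<sqinter> \<sim> (\<diamond> a) \<sqsubseteq> \<diamond> b"
  proof (rule le_diaI)
    fix d assume d: "d \<in> carrier B" "b \<prec> d"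
    show "\<diamond> (a \<squnion> b) \<sqinter> \<sim> (\<diamond> a) \<sqsubseteq> \<diamond> d"
      using d(1) *[OF d] by (auto simp: cl le_hom_iff hom_simps)
  qed (use cl in auto)
  then show ?thesis
    by (auto simp: cl le_hom_iff hom_simps)
qed

lemma dia_prec:
  assumes "a \<in> carrier B" "b \<in> carrier B" "a \<prec> b"
  shows "\<diamond> a \<prec> \<diamond> b"
  using de_Vries_additive[of a a b b] assms by (simp add: join_idem dia_closed)

section \<open>Algebraic counterparts of the axioms on strict implication\<close>

lemma zero_prec: "a \<in> carrier B \<Longrightarrow> \<zero> \<prec> a"
  by (metis le_def meet_comm meet_zero closed(4) prec_mono prec_zero)

lemma prec_one': "a \<in> carrier B \<Longrightarrow> a \<prec> \<one>"
  by (metis le_def meet_one closed(5) prec_trans_le prec_one)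

lemma one_prec_iff: "a \<in> carrier B \<Longrightarrow> \<one> \<prec> a \<longleftrightarrow> a = \<one>"
  by (metis le_def meet_comm meet_one closed(5) prec_le prec_one)

lemma compl_one: "\<sim> \<one> = \<zero>" and compl_zero: "\<sim> \<zero> = \<one>"
  by (auto intro!: eq_homI simp: hom_simps closed)

lemma compl_compl: "a \<in> carrier B \<Longrightarrow> \<sim> (\<sim> a) = a"
  by (auto intro!: eq_homI simp: hom_simps closed)

lemma le_join1: "\<lbrakk>a \<in> carrier B; b \<in> carrier B\<rbrakk> \<Longrightarrow> a \<sqsubseteq> a \<squnion> b"
  and le_join2: "\<lbrakk>a \<in> carrier B; b \<in> carrier B\<rbrakk> \<Longrightarrow> b \<sqsubseteq> a \<squnion> b"
  by (auto intro!: le_homI simp: hom_simps closed)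

lemma join_prec_iff:
  assumes "a \<in> carrier B" "b \<in> carrier B" "c \<in> carrier B"
  shows "a \<squnion> b \<prec> c \<longleftrightarrow> a \<prec> c \<and> b \<prec> c"
  using assms prec_join[of a b c] prec_trans_le[of a "a \<squnion> b" c] prec_trans_le[of b "a \<squnion> b" c]
  by (auto simp: le_join1 le_join2 closed)

lemma prec_meet_iff:
  assumes "a \<in> carrier B" "b \<in> carrier B" "c \<in> carrier B"
  shows "a \<prec> b \<sqinter> c \<longleftrightarrow> a \<prec> b \<and> a \<prec> c"
  using assms prec_meet[of a b c] prec_mono[of a a "b \<sqinter> c" b] prec_mono[of a a "b \<sqinter> c" c]
  by (auto simp: meet_le1 meet_le2 le_refl closed)

lemma prec_compl_iff:
  assumes "a \<in> carrier B" "b \<in> carrier B"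
  shows "\<sim> b \<prec> \<sim> a \<longleftrightarrow> a \<prec> b"
  using assms prec_compl[of a b] prec_compl[of "\<sim> b" "\<sim> a"] by (auto simp: compl_compl closed)

lemma ext_closed:
  assumes "\<forall>n. v n \<in> carrier B"
  shows "ext B v \<phi> \<in> carrier B"
  using assms by (induction \<phi>) (auto simp: closed dia_closed)

text \<open>Composing the value with a homomorphism gives a truth assignment to the template, so
  instances of tautologies are mapped to true by every \<open>h\<close>.\<close>

lemma ext_inst_hom:
  assumes "\<forall>n. v n \<in> carrier B" "bool_hom h"
  shows "h (ext B v (inst \<sigma> p)) \<longleftrightarrow> ptrue (\<lambda>n. h (ext B v (\<sigma> n))) p"
  using assms by (induction p) (auto simp: hom_simps closed ext_closed)

text \<open>Dually, the diamond of the complement of \<open>b\<close> must lie below a join of two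
  diamonds; monotonicity and \<open>dia_join_le\<close> provide this.\<close>

lemma ext_K:
  assumes ab: "a \<in> carrier B" "b \<in> carrier B"
  shows "\<sim> (\<diamond> (\<sim> ((\<sim> a) \<squnion> b))) \<sqsubseteq> (\<sim> (\<sim> (\<diamond> (\<sim> a)))) \<squnion> (\<sim> (\<diamond> (\<sim> b)))"
proof -
  note cl = ab closed dia_closed
  have "\<diamond> (\<sim> b) \<sqsubseteq> \<diamond> (\<sim> a \<squnion> \<sim> ((\<sim> a) \<squnion> b))"
    using cl by (intro dia_mono le_homI) (auto simp: hom_simps)
  moreover have "\<diamond> (\<sim> a \<squnion> \<sim> ((\<sim> a) \<squnion> b)) \<sqsubseteq> \<diamond> (\<sim> a) \<squnion> \<diamond> (\<sim> ((\<sim> a) \<squnion> b))"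
    using cl by (intro dia_join_le) auto
  ultimately have "\<diamond> (\<sim> b) \<sqsubseteq> \<diamond> (\<sim> a) \<squnion> \<diamond> (\<sim> ((\<sim> a) \<squnion> b))"
    by (auto simp: cl le_hom_iff)
  then show ?thesis
    by (auto simp: cl le_hom_iff hom_simps)
qed

text \<open>Induction on derivations. A strict formula only takes the values one and zero, so its
  axioms reduce to case distinctions on \<open>\<prec>\<close>; an implication or equivalence has
  value one exactly when the two sides are ordered or equal.\<close>

lemma soundness:
  assumes "MS2IC \<phi>" and v: "\<forall>n. v n \<in> carrier B"
  shows "ext B v \<phi> = \<one>"
  using assms(1)
proof induction
  case (Taut p \<sigma>)
  then show ?case
    using v by (intro eq_homI) (auto simp: ext_closed closed hom_simps ext_inst_hom tautology_def)
next
  case (K \<phi> \<psi>)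
  have "ext B v (\<box> (\<phi> \<^bold>\<longrightarrow> \<psi>)) \<sqsubseteq> ext B v (\<box> \<phi> \<^bold>\<longrightarrow> \<box> \<psi>)"
    using ext_K[of "ext B v \<phi>" "ext B v \<psi>"] v by (simp add: ext_closed)
  then show ?case
    using imp_eq_one_iff ext_closed[OF v] by (metis ext.simps(7))
next
  case (Add \<phi> \<psi>)
  have "\<sim> (\<diamond> (\<sim> ext B v \<phi>)) \<prec> \<sim> (\<diamond> (\<sim> ext B v \<psi>))" if "ext B v \<phi> \<prec> ext B v \<psi>"
    using that v by (intro prec_compl dia_prec) (auto simp: ext_closed closed dia_closed)
  then show ?case
    using v by (auto simp: compl_one compl_zero closed join_one join_compl join_zero zero_join one_join)
next
  case (MP \<phi> \<psi>)
  then show ?case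
    using imp_eq_one_iff[OF ext_closed[OF v] ext_closed[OF v]] v
    by (metis ext.simps(7) ext_closed le_def meet_comm meet_one one_closed)
next
  case (NecU \<phi>)
  then show ?case
    by (simp add: prec_one)
next
  case (Nec \<phi>)
  then show ?case
    by (simp add: compl_one compl_zero dia_zero)
next
  case (RE \<phi> \<phi>' \<psi> \<psi>')
  then show ?case
    using v by (simp add: iff_eq_one_iff ext_closed closed)
next
  case (A4 \<phi> \<psi>)
  have "ext B v \<phi> \<sqsubseteq> ext B v \<psi>" if "ext B v \<phi> \<prec> ext B v \<psi>"
    using that v by (simp add: ext_closed prec_le)
  then show ?case
    using v by (auto simp: imp_eq_one_iff ext_closed closed le_hom_iff hom_simps)
next
  case A1
  then show ?case
    using v by (simp add: zero_prec prec_one' ext_closed closed meet_one)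
next
  case A2
  then show ?case
    using v by (subst ext.simps, subst iff_eq_one_iff)
      (auto simp: ext_closed closed join_prec_iff meet_one meet_zero zero_meet)
next
  case A3
  then show ?case
    using v by (subst ext.simps, subst iff_eq_one_iff)
      (auto simp: ext_closed closed prec_meet_iff meet_one meet_zero zero_meet)
next
  case A5
  then show ?case
    using v by (subst ext.simps, subst iff_eq_one_iff)
      (auto simp: ext_closed closed prec_compl_iff)
next
  case A10
  then show ?case
    using v by (subst ext.simps, subst iff_eq_one_iff)
      (auto simp: ext_closed closed one_prec_iff)
next
  case A8
  then show ?case
    using v by (subst ext.simps, subst imp_eq_one_iff)
      (auto simp: ext_closed closed one_prec_iff le_refl)
next
  case A9
  then show ?case
    using v by (subst ext.simps, subst imp_eq_one_iff)
      (auto simp: ext_closed closed one_prec_iff le_refl compl_one compl_zero)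
next
  case A11
  then show ?case
    using v by (subst ext.simps, subst imp_eq_one_iff)
      (auto simp: ext_closed closed one_prec_iff le_refl compl_one compl_zero prec_zero)
qed

end

section \<open>Theories and maximal theories\<close>

text \<open>Strict and boxed formulas count as atoms here: nothing is asked of \<open>h\<close> on
  them.\<close>

definition boolean_valuation :: "(fm \<Rightarrow> bool) \<Rightarrow> bool" where
  "boolean_valuation h \<longleftrightarrow> h \<^bold>\<top> \<and> \<not> h \<^bold>\<bottom> \<and> (\<forall>\<phi>. h (\<^bold>\<not> \<phi>) = (\<not> h \<phi>)) \<and>
    (\<forall>\<phi> \<psi>. h (\<phi> \<^bold>\<and> \<psi>) = (h \<phi> \<and> h \<psi>)) \<and> (\<forall>\<phi> \<psi>. h (\<phi> \<^bold>\<or> \<psi>) = (h \<phi> \<or> h \<psi>)) \<and>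
    (\<forall>\<phi> \<psi>. h (\<phi> \<^bold>\<longrightarrow> \<psi>) = (h \<phi> \<longrightarrow> h \<psi>)) \<and>
    (\<forall>\<phi> \<psi>. h (\<phi> \<^bold>\<longleftrightarrow> \<psi>) = (h \<phi> \<longleftrightarrow> h \<psi>))"

instance fm :: countable
  by countable_datatype

text \<open>Strict and boxed formulas become propositional variables, like the variables themselves,
  indexed by their own codes so that \<open>from_nat\<close> reinstates them.\<close>

primrec skeleton :: "fm \<Rightarrow> pfm" where
  "skeleton (Var n) = PVar (to_nat (Var n))"
| "skeleton \<^bold>\<top> = PTop"
| "skeleton \<^bold>\<bottom> = PBot"
| "skeleton (\<^bold>\<not> \<phi>) = PNeg (skeleton \<phi>)"
| "skeleton (\<phi> \<^bold>\<and> \<psi>) = PAnd (skeleton \<phi>) (skeleton \<psi>)"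
| "skeleton (\<phi> \<^bold>\<or> \<psi>) = POr (skeleton \<phi>) (skeleton \<psi>)"
| "skeleton (\<phi> \<^bold>\<longrightarrow> \<psi>) = PImp (skeleton \<phi>) (skeleton \<psi>)"
| "skeleton (\<phi> \<^bold>\<longleftrightarrow> \<psi>) = PIff (skeleton \<phi>) (skeleton \<psi>)"
| "skeleton (\<phi> \<leadsto> \<psi>) = PVar (to_nat (\<phi> \<leadsto> \<psi>))"
| "skeleton (\<box> \<phi>) = PVar (to_nat (\<box> \<phi>))"

lemma inst_skeleton: "inst from_nat (skeleton \<phi>) = \<phi>"
  by (induction \<phi>) auto

text \<open>Truth of skeletons under an assignment is a Boolean valuation, so the skeleton is a
  tautology with the formula as an instance. Propositional derivations below are thereby replaced by
  semantic checks.\<close>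

lemma MS2IC_tautI:
  assumes "\<And>h. boolean_valuation h \<Longrightarrow> h \<phi>"
  shows "MS2IC \<phi>"
proof -
  have "boolean_valuation (\<lambda>\<psi>. ptrue t (skeleton \<psi>))" for t
    by (simp add: boolean_valuation_def)
  then have "tautology (skeleton \<phi>)"
    using assms unfolding tautology_def by blast
  then show ?thesis
    using MS2IC.Taut[of "skeleton \<phi>" from_nat] by (simp add: inst_skeleton)
qed

text \<open>Only modus ponens is required as closure: the necessitation rules and \<open>RE\<close>
  apply to theorems, not to arbitrary members of a theory.\<close>

definition mtheory :: "fm set \<Rightarrow> bool" where
  "mtheory F \<longleftrightarrow> (\<forall>\<theta>. MS2IC \<theta> \<longrightarrow> \<theta> \<in> F) \<and> (\<forall>\<alpha> \<beta>. (\<alpha> \<^bold>\<longrightarrow> \<beta>) \<in> F \<longrightarrow> \<alpha> \<in> F \<longrightarrow> \<beta> \<in> F)"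

definition maximal :: "fm set \<Rightarrow> bool" where
  "maximal F \<longleftrightarrow> mtheory F \<and> boolean_valuation (\<lambda>\<phi>. \<phi> \<in> F)"

lemma mtheory_theorem: "mtheory F \<Longrightarrow> MS2IC \<theta> \<Longrightarrow> \<theta> \<in> F"
  and mtheory_MP: "mtheory F \<Longrightarrow> (\<alpha> \<^bold>\<longrightarrow> \<beta>) \<in> F \<Longrightarrow> \<alpha> \<in> F \<Longrightarrow> \<beta> \<in> F"
  unfolding mtheory_def by blast+

lemma mtheory_taut1:
  assumes "mtheory F" "\<alpha> \<in> F" "\<And>h. boolean_valuation h \<Longrightarrow> h \<alpha> \<Longrightarrow> h \<beta>"
  shows "\<beta> \<in> F"
proof -
  have "MS2IC (\<alpha> \<^bold>\<longrightarrow> \<beta>)"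
    using assms(3) by (intro MS2IC_tautI) (auto simp: boolean_valuation_def)
  then show ?thesis
    using assms mtheory_theorem mtheory_MP by blast
qed

lemma mtheory_taut2:
  assumes "mtheory F" "\<alpha> \<in> F" "\<beta> \<in> F" "\<And>h. boolean_valuation h \<Longrightarrow> h \<alpha> \<Longrightarrow> h \<beta> \<Longrightarrow> h \<gamma>"
  shows "\<gamma> \<in> F"
proof -
  have "MS2IC (\<alpha> \<^bold>\<longrightarrow> \<beta> \<^bold>\<longrightarrow> \<gamma>)"
    using assms(4) by (intro MS2IC_tautI) (auto simp: boolean_valuation_def)
  then have "(\<alpha> \<^bold>\<longrightarrow> \<beta> \<^bold>\<longrightarrow> \<gamma>) \<in> F"
    by (rule mtheory_theorem[OF assms(1)])
  then show ?thesis
    using mtheory_MP[OF assms(1)] assms(2,3) by blast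
qed

lemma maximal_simps:
  assumes "maximal F"
  shows "\<^bold>\<top> \<in> F" "\<^bold>\<bottom> \<notin> F" "(\<^bold>\<not> \<phi>) \<in> F \<longleftrightarrow> \<phi> \<notin> F" "\<phi> \<^bold>\<and> \<psi> \<in> F \<longleftrightarrow> \<phi> \<in> F \<and> \<psi> \<in> F"
    "\<phi> \<^bold>\<or> \<psi> \<in> F \<longleftrightarrow> \<phi> \<in> F \<or> \<psi> \<in> F" "(\<phi> \<^bold>\<longrightarrow> \<psi>) \<in> F \<longleftrightarrow> (\<phi> \<in> F \<longrightarrow> \<psi> \<in> F)"
    "(\<phi> \<^bold>\<longleftrightarrow> \<psi>) \<in> F \<longleftrightarrow> (\<phi> \<in> F \<longleftrightarrow> \<psi> \<in> F)"
  using assms by (simp_all add: maximal_def boolean_valuation_def)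

lemma maximal_theorem: "maximal F \<Longrightarrow> MS2IC \<theta> \<Longrightarrow> \<theta> \<in> F"
  unfolding maximal_def mtheory_def by blast

text \<open>The set of \<open>\<theta>\<close> implied by \<open>\<psi>\<close> over
  \<open>F\<close> serves as the theory generated by \<open>F\<close> and \<open>\<psi>\<close>, as
  in the deduction theorem.\<close>

lemma mtheory_extend:
  assumes "mtheory F"
  shows "mtheory {\<theta>. (\<psi> \<^bold>\<longrightarrow> \<theta>) \<in> F}" "F \<subseteq> {\<theta>. (\<psi> \<^bold>\<longrightarrow> \<theta>) \<in> F}" "(\<psi> \<^bold>\<longrightarrow> \<psi>) \<in> F"
proof -
  show sub: "F \<subseteq> {\<theta>. (\<psi> \<^bold>\<longrightarrow> \<theta>) \<in> F}"
    using mtheory_taut1[OF assms] by (auto simp: boolean_valuation_def)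
  have "(\<psi> \<^bold>\<longrightarrow> \<beta>) \<in> F" if "(\<psi> \<^bold>\<longrightarrow> \<alpha> \<^bold>\<longrightarrow> \<beta>) \<in> F" "(\<psi> \<^bold>\<longrightarrow> \<alpha>) \<in> F" for \<alpha> \<beta>
    using mtheory_taut2[OF assms that] by (simp add: boolean_valuation_def)
  then show "mtheory {\<theta>. (\<psi> \<^bold>\<longrightarrow> \<theta>) \<in> F}"
    using sub mtheory_theorem[OF assms] unfolding mtheory_def by blast
  show "(\<psi> \<^bold>\<longrightarrow> \<psi>) \<in> F"
    by (intro mtheory_theorem[OF assms] MS2IC_tautI) (simp add: boolean_valuation_def)
qed

text \<open>Zorn's lemma yields a theory maximal among those omitting \<open>\<chi>\<close>. It
  decides every formula, since otherwise \<open>\<chi>\<close> would follow from both a formula and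
  its negation.\<close>

lemma Lindenbaum:
  assumes F0: "mtheory F0" "\<chi> \<notin> F0"
  obtains F where "maximal F" "F0 \<subseteq> F" "\<chi> \<notin> F"
proof -
  define Q where "Q = {F. mtheory F \<and> F0 \<subseteq> F \<and> \<chi> \<notin> F}"
  have "\<exists>F\<in>Q. \<forall>G\<in>Q. F \<subseteq> G \<longrightarrow> G = F"
  proof (rule subset_Zorn_nonempty)
    show "Q \<noteq> {}"
      using F0 by (auto simp: Q_def)
    fix C assume C: "C \<noteq> {}" "subset.chain Q C"
    then have CQ: "\<And>F. F \<in> C \<Longrightarrow> mtheory F \<and> F0 \<subseteq> F \<and> \<chi> \<notin> F"
      by (auto simp: subset.chain_def Q_def)
    \<comment> \<open>Of two members of a chain one contains the other, so both premises meet in a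
      single theory.\<close>
    have "\<beta> \<in> \<Union>C" if ab: "(\<alpha> \<^bold>\<longrightarrow> \<beta>) \<in> \<Union>C" "\<alpha> \<in> \<Union>C" for \<alpha> \<beta>
    proof -
      obtain F G where FG: "F \<in> C" "G \<in> C" "(\<alpha> \<^bold>\<longrightarrow> \<beta>) \<in> F" "\<alpha> \<in> G"
        using ab by auto
      moreover have "F \<subseteq> G \<or> G \<subseteq> F"
        using C FG by (auto simp: subset.chain_def)
      ultimately have "\<beta> \<in> F \<or> \<beta> \<in> G"
        using mtheory_MP[of F \<alpha> \<beta>] mtheory_MP[of G \<alpha> \<beta>] CQ by blast
      then show ?thesis
        using FG by auto
    qed
    then show "\<Union>C \<in> Q"
      using CQ C(1) unfolding Q_def mtheory_def by blast
  qed
  then obtain F where F: "mtheory F" "F0 \<subseteq> F" "\<chi> \<notin> F"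
    and maxF: "\<And>G. \<lbrakk>mtheory G; \<chi> \<notin> G; F \<subseteq> G\<rbrakk> \<Longrightarrow> G = F"
    unfolding Q_def by (metis (mono_tags, lifting) mem_Collect_eq order_trans)
  note taut1 = mtheory_taut1[OF F(1)] and taut2 = mtheory_taut2[OF F(1)]
  have ext: "(\<psi> \<^bold>\<longrightarrow> \<chi>) \<in> F" if "\<psi> \<notin> F" for \<psi>
    using maxF[of "{\<theta>. (\<psi> \<^bold>\<longrightarrow> \<theta>) \<in> F}"] mtheory_extend[OF F(1), of \<psi>] that by blast
  have total: "\<psi> \<in> F \<or> (\<^bold>\<not> \<psi>) \<in> F" for \<psi>
  proof (rule ccontr)
    assume "\<not> ?thesis"
    then have "\<chi> \<in> F"
      using taut2[OF ext[of \<psi>] ext[of "\<^bold>\<not> \<psi>"]] by (auto simp: boolean_valuation_def)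
    then show False
      using F by auto
  qed
  have top: "\<^bold>\<top> \<in> F"
    by (intro mtheory_theorem[OF F(1)] MS2IC_tautI) (simp add: boolean_valuation_def)
  have bot: "\<^bold>\<bottom> \<notin> F"
    using taut1[of "\<^bold>\<bottom>" \<chi>] F(3) by (auto simp: boolean_valuation_def)
  have neg: "(\<^bold>\<not> \<psi>) \<in> F \<longleftrightarrow> \<psi> \<notin> F" for \<psi>
    using total taut2[of \<psi> "\<^bold>\<not> \<psi>" "\<^bold>\<bottom>"] bot by (auto simp: boolean_valuation_def)
  have and_: "\<phi> \<^bold>\<and> \<psi> \<in> F \<longleftrightarrow> \<phi> \<in> F \<and> \<psi> \<in> F" for \<phi> \<psi>
    using taut1[of "\<phi> \<^bold>\<and> \<psi>" \<phi>] taut1[of "\<phi> \<^bold>\<and> \<psi>" \<psi>] taut2[of \<phi> \<psi> "\<phi> \<^bold>\<and> \<psi>"]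
    by (auto simp: boolean_valuation_def)
  \<comment> \<open>The remaining connectives are reduced to negation and conjunction.\<close>
  have equiv: "\<phi> \<in> F \<longleftrightarrow> \<psi> \<in> F" if "\<And>h. boolean_valuation h \<Longrightarrow> h \<phi> = h \<psi>" for \<phi> \<psi>
    using taut1 that by blast
  have or_: "\<phi> \<^bold>\<or> \<psi> \<in> F \<longleftrightarrow> \<phi> \<in> F \<or> \<psi> \<in> F" for \<phi> \<psi>
    using equiv[of "\<phi> \<^bold>\<or> \<psi>" "\<^bold>\<not> (\<^bold>\<not> \<phi> \<^bold>\<and> \<^bold>\<not> \<psi>)"] by (simp add: neg and_ boolean_valuation_def)
  have imp: "(\<phi> \<^bold>\<longrightarrow> \<psi>) \<in> F \<longleftrightarrow> (\<phi> \<in> F \<longrightarrow> \<psi> \<in> F)" for \<phi> \<psi>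
    using equiv[of "\<phi> \<^bold>\<longrightarrow> \<psi>" "\<^bold>\<not> (\<phi> \<^bold>\<and> \<^bold>\<not> \<psi>)"] by (simp add: neg and_ boolean_valuation_def)
  have iff: "(\<phi> \<^bold>\<longleftrightarrow> \<psi>) \<in> F \<longleftrightarrow> (\<phi> \<in> F \<longleftrightarrow> \<psi> \<in> F)" for \<phi> \<psi>
    using equiv[of "\<phi> \<^bold>\<longleftrightarrow> \<psi>" "(\<phi> \<^bold>\<longrightarrow> \<psi>) \<^bold>\<and> (\<psi> \<^bold>\<longrightarrow> \<phi>)"]
    by (auto simp: imp and_ boolean_valuation_def)
  have "maximal F"
    using F(1) by (simp add: maximal_def boolean_valuation_def top bot neg and_ or_ imp iff)
  then show ?thesis
    using F that by blast
qed

section \<open>The canonical frame\<close>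

locale canonical =
  fixes \<Gamma> :: "fm set"
  assumes max: "maximal \<Gamma>"
begin

abbreviation prec_fm :: "fm \<Rightarrow> fm \<Rightarrow> bool" (infix \<open>\<lless>\<close> 50) where
  "\<phi> \<lless> \<psi> \<equiv> (\<phi> \<leadsto> \<psi>) \<in> \<Gamma>"

text \<open>Here \<open>RE\<close> enters: Boolean equivalents have a provable biconditional, and
  the rule makes the two strict formulas provably equivalent.\<close>

lemma prec_fm_cong:
  assumes "\<phi> \<lless> \<psi>" "\<And>h. boolean_valuation h \<Longrightarrow> h \<phi> = h \<phi>'" "\<And>h. boolean_valuation h \<Longrightarrow> h \<psi> = h \<psi>'"
  shows "\<phi>' \<lless> \<psi>'"
proof -
  have "MS2IC (\<phi> \<^bold>\<longleftrightarrow> \<phi>')" "MS2IC (\<psi> \<^bold>\<longleftrightarrow> \<psi>')"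
    using assms(2,3) by (auto intro!: MS2IC_tautI simp: boolean_valuation_def)
  then have "((\<phi> \<leadsto> \<psi>) \<^bold>\<longleftrightarrow> (\<phi>' \<leadsto> \<psi>')) \<in> \<Gamma>"
    by (intro maximal_theorem[OF max] MS2IC.RE)
  then show ?thesis
    using assms(1) max by (simp add: maximal_simps)
qed

lemma prec_fm_or: "\<phi> \<^bold>\<or> \<psi> \<lless> \<chi> \<longleftrightarrow> \<phi> \<lless> \<chi> \<and> \<psi> \<lless> \<chi>"
  using maximal_theorem[OF max MS2IC.A2[of \<phi> \<psi> \<chi>]] max by (simp add: maximal_simps)

lemma prec_fm_and: "\<phi> \<lless> \<psi> \<^bold>\<and> \<chi> \<longleftrightarrow> \<phi> \<lless> \<psi> \<and> \<phi> \<lless> \<chi>"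
  using maximal_theorem[OF max MS2IC.A3[of \<phi> \<psi> \<chi>]] max by (simp add: maximal_simps)

lemma prec_fm_neg: "\<^bold>\<not> \<psi> \<lless> \<^bold>\<not> \<phi> \<longleftrightarrow> \<phi> \<lless> \<psi>"
  using maximal_theorem[OF max MS2IC.A5[of \<phi> \<psi>]] max by (simp add: maximal_simps)

text \<open>Since \<open>\<phi>\<close> is equivalent to its disjunction with
  \<open>\<phi>'\<close>, axiom \<open>A2\<close> splits off the second disjunct;
  \<open>prec_fm_right\<close> is dual, with \<open>A3\<close>.\<close>

lemma prec_fm_left:
  assumes "\<phi> \<lless> \<psi>" "\<And>h. boolean_valuation h \<Longrightarrow> h \<phi>' \<Longrightarrow> h \<phi>"
  shows "\<phi>' \<lless> \<psi>"
proof -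
  have "\<phi>' \<^bold>\<or> \<phi> \<lless> \<psi>"
    using assms by (intro prec_fm_cong[OF assms(1)]) (auto simp: boolean_valuation_def)
  then show ?thesis
    by (simp add: prec_fm_or)
qed

lemma prec_fm_right:
  assumes "\<phi> \<lless> \<psi>" "\<And>h. boolean_valuation h \<Longrightarrow> h \<psi> \<Longrightarrow> h \<psi>'"
  shows "\<phi> \<lless> \<psi>'"
proof -
  have "\<phi> \<lless> \<psi>' \<^bold>\<and> \<psi>"
    using assms by (intro prec_fm_cong[OF assms(1)]) (auto simp: boolean_valuation_def)
  then show ?thesis
    by (simp add: prec_fm_and)
qed

lemma prec_fm_meet:
  assumes "\<phi> \<lless> \<psi>" "\<phi>' \<lless> \<psi>'"
  shows "\<phi> \<^bold>\<and> \<phi>' \<lless> \<psi> \<^bold>\<and> \<psi>'"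
  using prec_fm_left[OF assms(1), of "\<phi> \<^bold>\<and> \<phi>'"] prec_fm_left[OF assms(2), of "\<phi> \<^bold>\<and> \<phi>'"]
  by (simp add: prec_fm_and boolean_valuation_def)

lemma prec_fm_theorem: "MS2IC \<theta> \<Longrightarrow> \<phi> \<lless> \<theta>"
  using maximal_theorem[OF max MS2IC.NecU[of \<theta>]]
  by (rule prec_fm_left) (simp_all add: boolean_valuation_def)

lemma prec_fm_box: "\<phi> \<lless> \<psi> \<Longrightarrow> \<box>\<phi> \<lless> \<box>\<psi>"
  using maximal_theorem[OF max MS2IC.Add[of \<phi> \<psi>]] max by (simp add: maximal_simps)

text \<open>The inclusion forces agreement with \<open>\<Gamma>\<close> on all strict formulas; see
  \<open>strict_mem_iff\<close>.\<close>

definition worlds :: "fm set set" where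
  "worlds = {x. maximal x \<and> {\<theta>. \<^bold>\<top> \<lless> \<theta>} \<subseteq> x}"

definition up_set :: "fm set \<Rightarrow> fm set" where
  "up_set x = {\<beta>. \<exists>\<alpha>\<in>x. \<alpha> \<lless> \<beta>}"

text \<open>The relation that represents \<open>\<leadsto>\<close>. It is written asymmetrically,
  but \<open>A5\<close> makes it symmetric.\<close>

definition edges :: "(fm set \<times> fm set) set" where
  "edges = {(x, y). x \<in> worlds \<and> y \<in> worlds \<and> up_set x \<subseteq> y}"

text \<open>The usual canonical accessibility relation; maximality of the target is demanded
  separately wherever it is used.\<close>

definition succ :: "fm set \<Rightarrow> fm set \<Rightarrow> bool" where
  "succ x y \<longleftrightarrow> {\<theta>. \<box>\<theta> \<in> x} \<subseteq> y"

lemma worlds_maximal: "x \<in> worlds \<Longrightarrow> maximal x"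
  by (simp add: worlds_def)

lemma mtheory_up_set:
  assumes "maximal x"
  shows "mtheory (up_set x)"
proof -
  have "\<theta> \<in> up_set x" if "MS2IC \<theta>" for \<theta>
    using prec_fm_theorem[OF that] maximal_simps(1)[OF assms] by (auto simp: up_set_def)
  moreover have "\<beta> \<in> up_set x" if ab: "(\<alpha> \<^bold>\<longrightarrow> \<beta>) \<in> up_set x" "\<alpha> \<in> up_set x" for \<alpha> \<beta>
  proof -
    obtain \<gamma> \<delta> where *: "\<gamma> \<in> x" "\<delta> \<in> x" "\<gamma> \<lless> \<alpha> \<^bold>\<longrightarrow> \<beta>" "\<delta> \<lless> \<alpha>"
      using ab by (auto simp: up_set_def)
    have "\<gamma> \<^bold>\<and> \<delta> \<lless> \<beta>"
      by (rule prec_fm_right[OF prec_fm_meet[OF *(3,4)]]) (simp add: boolean_valuation_def)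
    then show ?thesis
      using * assms unfolding up_set_def by (blast intro: maximal_simps(4)[THEN iffD2])
  qed
  ultimately show ?thesis
    by (auto simp: mtheory_def)
qed

lemma prec_top_up_set: "maximal x \<Longrightarrow> \<^bold>\<top> \<lless> \<theta> \<Longrightarrow> \<theta> \<in> up_set x"
  unfolding up_set_def using maximal_simps(1) by blast

text \<open>By \<open>A10\<close> a strict formula of \<open>\<Gamma>\<close> belongs to every
  world, and \<open>A4\<close> weakens it there to an implication.\<close>

lemma edge_refl:
  assumes "x \<in> worlds"
  shows "(x, x) \<in> edges"
proof -
  have "\<beta> \<in> x" if "\<alpha> \<in> x" "\<alpha> \<lless> \<beta>" for \<alpha> \<beta>
  proof -
    have "\<^bold>\<top> \<lless> \<alpha> \<leadsto> \<beta>"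
      using maximal_theorem[OF max MS2IC.A10[of \<alpha> \<beta>]] that max by (simp add: maximal_simps)
    then have "(\<alpha> \<leadsto> \<beta>) \<in> x"
      using assms by (auto simp: worlds_def)
    moreover have "((\<alpha> \<leadsto> \<beta>) \<^bold>\<longrightarrow> (\<alpha> \<^bold>\<longrightarrow> \<beta>)) \<in> x"
      using worlds_maximal[OF assms] by (rule maximal_theorem) (rule MS2IC.A4)
    ultimately show ?thesis
      using worlds_maximal[OF assms] that by (simp add: maximal_simps)
  qed
  then show ?thesis
    using assms by (auto simp: edges_def up_set_def)
qed

text \<open>Contraposition by \<open>A5\<close>: a \<open>\<beta>\<close> missing from
  \<open>x\<close> would send the negation of \<open>\<alpha>\<close> into \<open>y\<close>.\<close>

lemma edge_sym:
  assumes "(x, y) \<in> edges"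
  shows "(y, x) \<in> edges"
proof -
  have xy: "maximal x" "maximal y"
    using assms by (auto simp: edges_def worlds_def)
  have "\<beta> \<in> x" if "\<alpha> \<in> y" "\<alpha> \<lless> \<beta>" for \<alpha> \<beta>
  proof (rule ccontr)
    assume "\<beta> \<notin> x"
    then have "(\<^bold>\<not> \<beta>) \<in> x" "\<^bold>\<not> \<beta> \<lless> \<^bold>\<not> \<alpha>"
      using xy that by (auto simp: maximal_simps prec_fm_neg)
    then have "(\<^bold>\<not> \<alpha>) \<in> y"
      using assms by (auto simp: edges_def up_set_def)
    then show False
      using xy that by (simp add: maximal_simps)
  qed
  then show ?thesis
    using assms by (auto simp: edges_def up_set_def)
qed

text \<open>\<open>A10\<close> passes the truth of a strict formula from \<open>\<Gamma>\<close> to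
  every world, and \<open>A9\<close> passes its failure.\<close>

lemma strict_mem_iff:
  assumes "x \<in> worlds"
  shows "(\<phi> \<leadsto> \<psi>) \<in> x \<longleftrightarrow> \<phi> \<lless> \<psi>"
proof
  have A10: "\<phi> \<lless> \<psi> \<longleftrightarrow> \<^bold>\<top> \<lless> \<phi> \<leadsto> \<psi>"
    using maximal_theorem[OF max MS2IC.A10[of \<phi> \<psi>]] max by (simp add: maximal_simps)
  show "(\<phi> \<leadsto> \<psi>) \<in> x" if "\<phi> \<lless> \<psi>"
    using that A10 assms by (auto simp: worlds_def)
  show "\<phi> \<lless> \<psi>" if "(\<phi> \<leadsto> \<psi>) \<in> x"
  proof (rule ccontr)
    assume "\<not> \<phi> \<lless> \<psi>"
    then have "\<^bold>\<top> \<lless> \<^bold>\<not> ([\<^bold>\<forall>](\<phi> \<leadsto> \<psi>))"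
      using A10 maximal_theorem[OF max MS2IC.A9[of "\<phi> \<leadsto> \<psi>"]] max by (simp add: maximal_simps)
    then have "(\<^bold>\<not> ([\<^bold>\<forall>](\<phi> \<leadsto> \<psi>))) \<in> x"
      using assms by (auto simp: worlds_def)
    then show False
      using that maximal_theorem[OF worlds_maximal[OF assms] MS2IC.A10[of \<phi> \<psi>]] worlds_maximal[OF assms]
      by (simp add: maximal_simps)
  qed
qed

text \<open>If \<open>\<phi> \<lless> \<psi>\<close> fails, the theory of all
  \<open>\<theta>\<close> with \<open>\<phi> \<lless> \<theta>\<close> extends to a \<open>y\<close>
  omitting \<open>\<psi>\<close>. By contraposition \<open>up_set y\<close> omits the negation of
  \<open>\<phi>\<close>, so it extends to an \<open>x\<close> containing
  \<open>\<phi>\<close>.\<close>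

lemma prec_fm_iff_edges:
  "\<phi> \<lless> \<psi> \<longleftrightarrow> (\<forall>(x, y)\<in>edges. \<phi> \<in> x \<longrightarrow> \<psi> \<in> y)"
proof
  show "\<forall>(x, y)\<in>edges. \<phi> \<in> x \<longrightarrow> \<psi> \<in> y" if "\<phi> \<lless> \<psi>"
    using that by (auto simp: edges_def up_set_def)
next
  assume all: "\<forall>(x, y)\<in>edges. \<phi> \<in> x \<longrightarrow> \<psi> \<in> y"
  show "\<phi> \<lless> \<psi>"
  proof (rule ccontr)
    assume n: "\<not> \<phi> \<lless> \<psi>"
    have "\<phi> \<lless> \<beta>" if "\<phi> \<lless> \<alpha> \<^bold>\<longrightarrow> \<beta>" "\<phi> \<lless> \<alpha>" for \<alpha> \<beta>
    proof -
      have "\<phi> \<lless> (\<alpha> \<^bold>\<longrightarrow> \<beta>) \<^bold>\<and> \<alpha>"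
        using that by (simp add: prec_fm_and)
      then show ?thesis
        by (rule prec_fm_right) (simp add: boolean_valuation_def)
    qed
    then have "mtheory {\<theta>. \<phi> \<lless> \<theta>}"
      using prec_fm_theorem by (auto simp: mtheory_def)
    then obtain y where y: "maximal y" "{\<theta>. \<phi> \<lless> \<theta>} \<subseteq> y" "\<psi> \<notin> y"
      using Lindenbaum[of "{\<theta>. \<phi> \<lless> \<theta>}" \<psi>] n by auto
    have "\<phi> \<lless> \<theta>" if "\<^bold>\<top> \<lless> \<theta>" for \<theta>
      using that by (rule prec_fm_left) (simp add: boolean_valuation_def)
    then have yw: "y \<in> worlds"
      using y by (auto simp: worlds_def)
    have "(\<^bold>\<not> \<phi>) \<notin> up_set y"
    proof
      assume "(\<^bold>\<not> \<phi>) \<in> up_set y"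
      then obtain \<gamma> where g: "\<gamma> \<in> y" "\<gamma> \<lless> \<^bold>\<not> \<phi>"
        by (auto simp: up_set_def)
      then have "\<^bold>\<not> (\<^bold>\<not> \<phi>) \<lless> \<^bold>\<not> \<gamma>"
        by (simp add: prec_fm_neg)
      then have "\<phi> \<lless> \<^bold>\<not> \<gamma>"
        by (rule prec_fm_left) (simp add: boolean_valuation_def)
      then have "(\<^bold>\<not> \<gamma>) \<in> y"
        using y by auto
      then show False
        using g y by (simp add: maximal_simps)
    qed
    then obtain x where x: "maximal x" "up_set y \<subseteq> x" "(\<^bold>\<not> \<phi>) \<notin> x"
      using Lindenbaum[OF mtheory_up_set[OF y(1)]] by blast
    have "x \<in> worlds"
      using x prec_top_up_set[OF y(1)] by (auto simp: worlds_def)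
    \<comment> \<open>The construction yields the edge from \<open>y\<close> to \<open>x\<close>;
      symmetry turns it around.\<close>
    then have "(x, y) \<in> edges"
      using x yw by - (rule edge_sym, simp add: edges_def)
    then show False
      using all x y by (auto simp: maximal_simps)
  qed
qed

section \<open>Boxes and the canonical accessibility relation\<close>

lemma mtheory_box:
  assumes "maximal x"
  shows "mtheory {\<theta>. \<box>\<theta> \<in> x}"
proof -
  have "\<box>\<beta> \<in> x" if "\<box>(\<alpha> \<^bold>\<longrightarrow> \<beta>) \<in> x" "\<box>\<alpha> \<in> x" for \<alpha> \<beta>
    using that maximal_theorem[OF assms MS2IC.K[of \<alpha> \<beta>]] assms by (simp add: maximal_simps)
  then show ?thesis
    using maximal_theorem[OF assms] MS2IC.Nec by (auto simp: mtheory_def)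
qed

lemma box_mem_iff:
  assumes "x \<in> worlds"
  shows "\<box>\<psi> \<in> x \<longleftrightarrow> (\<forall>y. maximal y \<longrightarrow> succ x y \<longrightarrow> \<psi> \<in> y)"
  using Lindenbaum[OF mtheory_box[OF worlds_maximal[OF assms]], of \<psi>]
  unfolding succ_def by blast

text \<open>\<open>Add\<close> turns \<open>\<top> \<lless> \<theta>\<close> into the same relation
  between the boxes; as the box of truth lies in \<open>x\<close>, the reflexive edge at
  \<open>x\<close> brings in \<open>\<box>\<theta>\<close>.\<close>

lemma succ_worlds:
  assumes "x \<in> worlds" "maximal y" "succ x y"
  shows "y \<in> worlds"
proof -
  have "\<box>\<theta> \<in> x" if "\<^bold>\<top> \<lless> \<theta>" for \<theta>
  proof -
    have "\<box>\<^bold>\<top> \<in> x"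
      by (intro maximal_theorem[OF worlds_maximal[OF assms(1)]] MS2IC.Nec MS2IC_tautI)
        (simp add: boolean_valuation_def)
    then show ?thesis
      using prec_fm_box[OF that] edge_refl[OF assms(1)] by (auto simp: edges_def up_set_def)
  qed
  then show ?thesis
    using assms by (auto simp: worlds_def succ_def)
qed

text \<open>The frame condition behind \<open>Add\<close>: a successor can be carried across an
  edge.\<close>

lemma succ_edge_commute:
  assumes xx': "(x, x') \<in> edges" and xy: "maximal y" "succ x y"
  obtains y' where "maximal y'" "succ x' y'" "(y, y') \<in> edges"
proof -
  have x: "x \<in> worlds" "x' \<in> worlds" "maximal x" "maximal x'"
    using xx' by (auto simp: edges_def worlds_def)
  have y: "y \<in> worlds"
    using succ_worlds x xy by blast
  \<comment> \<open>The theory generated by \<open>up_set y\<close> and the formulas boxed in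
    \<open>x'\<close>. A maximal theory above it is both a successor of \<open>x'\<close> and a
    neighbour of \<open>y\<close>.\<close>
  define G where "G = {\<theta>. \<exists>\<beta>\<in>up_set y. \<box>(\<beta> \<^bold>\<longrightarrow> \<theta>) \<in> x'}"
  note up_set = mtheory_up_set[OF xy(1)] and box = mtheory_box[OF x(4)]
  have top: "\<^bold>\<top> \<in> up_set y"
    by (intro mtheory_theorem[OF up_set] MS2IC_tautI) (simp add: boolean_valuation_def)
  have boxG: "\<theta> \<in> G" if "\<box>\<theta> \<in> x'" for \<theta>
    using mtheory_taut1[OF box, of \<theta> "\<^bold>\<top> \<^bold>\<longrightarrow> \<theta>"] that top
    by (auto simp: boolean_valuation_def G_def)
  have up_setG: "\<beta> \<in> G" if "\<beta> \<in> up_set y" for \<beta>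
  proof -
    have "\<box>(\<beta> \<^bold>\<longrightarrow> \<beta>) \<in> x'"
      using mtheory_theorem[OF box, of "\<beta> \<^bold>\<longrightarrow> \<beta>"] MS2IC_tautI[of "\<beta> \<^bold>\<longrightarrow> \<beta>"]
      by (simp add: boolean_valuation_def)
    then show ?thesis
      using that by (auto simp: G_def)
  qed
  have "\<beta> \<in> G" if "(\<alpha> \<^bold>\<longrightarrow> \<beta>) \<in> G" "\<alpha> \<in> G" for \<alpha> \<beta>
  proof -
    obtain \<gamma> \<delta> where *: "\<gamma> \<in> up_set y" "\<delta> \<in> up_set y"
      "\<box>(\<gamma> \<^bold>\<longrightarrow> \<alpha> \<^bold>\<longrightarrow> \<beta>) \<in> x'" "\<box>(\<delta> \<^bold>\<longrightarrow> \<alpha>) \<in> x'"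
      using \<open>(\<alpha> \<^bold>\<longrightarrow> \<beta>) \<in> G\<close> \<open>\<alpha> \<in> G\<close> by (auto simp: G_def)
    have "\<gamma> \<^bold>\<and> \<delta> \<in> up_set y"
      using mtheory_taut2[OF up_set *(1,2)] by (simp add: boolean_valuation_def)
    moreover have "\<box>(\<gamma> \<^bold>\<and> \<delta> \<^bold>\<longrightarrow> \<beta>) \<in> x'"
      using mtheory_taut2[OF box, of "\<gamma> \<^bold>\<longrightarrow> \<alpha> \<^bold>\<longrightarrow> \<beta>" "\<delta> \<^bold>\<longrightarrow> \<alpha>" "\<gamma> \<^bold>\<and> \<delta> \<^bold>\<longrightarrow> \<beta>"] *
      by (simp add: boolean_valuation_def)
    ultimately show ?thesis
      by (auto simp: G_def)
  qed
  moreover have "\<theta> \<in> G" if "MS2IC \<theta>" for \<theta>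
    using mtheory_theorem[OF box that] by (intro boxG) simp
  ultimately have "mtheory G"
    by (auto simp: mtheory_def)
  \<comment> \<open>An inconsistency boxes the negation of some \<open>\<beta>\<close> in
    \<open>x'\<close>, where \<open>\<alpha> \<lless> \<beta>\<close> and
    \<open>\<alpha> \<in> y\<close>. Contraposition, \<open>Add\<close> and the reversed edge box
    the negation of \<open>\<alpha>\<close> in \<open>x\<close>, which contradicts
    \<open>succ x y\<close>.\<close>
  moreover have "\<^bold>\<bottom> \<notin> G"
  proof
    assume "\<^bold>\<bottom> \<in> G"
    then obtain \<alpha> \<beta> where *: "\<alpha> \<in> y" "\<alpha> \<lless> \<beta>" "\<box>(\<beta> \<^bold>\<longrightarrow> \<^bold>\<bottom>) \<in> x'"
      by (auto simp: G_def up_set_def)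
    have "\<^bold>\<not> \<beta> \<lless> \<^bold>\<not> \<alpha>"
      using * by (simp add: prec_fm_neg)
    then have "\<beta> \<^bold>\<longrightarrow> \<^bold>\<bottom> \<lless> \<^bold>\<not> \<alpha>"
      by (rule prec_fm_left) (simp add: boolean_valuation_def)
    then have "\<box>(\<^bold>\<not> \<alpha>) \<in> x"
      using prec_fm_box * edge_sym[OF xx'] by (auto simp: edges_def up_set_def)
    then have "(\<^bold>\<not> \<alpha>) \<in> y"
      using xy by (auto simp: succ_def)
    then show False
      using * xy by (simp add: maximal_simps)
  qed
  ultimately obtain y' where y': "maximal y'" "G \<subseteq> y'"
    using Lindenbaum by blast
  have "y' \<in> worlds"
    using y' up_setG prec_top_up_set[OF xy(1)] by (auto simp: worlds_def)
  then have "(y, y') \<in> edges" "succ x' y'"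
    using y y' up_setG boxG by (auto simp: edges_def succ_def)
  then show ?thesis
    using that y' by blast
qed

end

section \<open>The algebra of a frame\<close>

text \<open>Names for the members of the generated subalgebra. Being countably many, they keep the
  carrier countable, as the later embedding into an arbitrary infinite type requires.\<close>

datatype set_term =
    Gen nat
  | Level nat
  | SCompl set_term
  | SInter set_term set_term
  | SPre set_term
  | SSwap set_term

instance set_term :: countable
  by countable_datatype

locale frame =
  fixes E :: "('w \<times> 'w) set" and S :: "'w \<Rightarrow> 'w \<Rightarrow> bool" and g :: "nat \<Rightarrow> 'w set"
  assumes E_sym: "(x, y) \<in> E \<Longrightarrow> (y, x) \<in> E"
    and E_refl: "(x, y) \<in> E \<Longrightarrow> (x, x) \<in> E"
begin

definition points :: "('w \<times> 'w \<times> nat) set" where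
  "points = {(x, y, n). (x, y) \<in> E}"

definition cyl :: "'w set \<Rightarrow> ('w \<times> 'w \<times> nat) set" where
  "cyl a = {(x, y, n) \<in> points. x \<in> a}"

text \<open>Edge reversal is a generator so that the symmetrised cylinder in
  \<open>cyl_prec_iff\<close> stays in the carrier.\<close>

definition swap_set :: "('w \<times> 'w \<times> nat) set \<Rightarrow> ('w \<times> 'w \<times> nat) set" where
  "swap_set a = {(x, y, n) \<in> points. (y, x, n) \<in> a}"

definition pre :: "('w \<times> 'w \<times> nat) set \<Rightarrow> ('w \<times> 'w \<times> nat) set" where
  "pre a = {(x, y, n) \<in> points. \<exists>x' y'. S x x' \<and> S y y' \<and> (x', y', n) \<in> points \<and> (x', y', n) \<in> a}"

text \<open>The points \<open>(x, y, n)\<close> and \<open>(y, x, n)\<close> are thought of as converging, as \<open>n\<close> grows, to one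
  limit point for the edge between \<open>x\<close> and \<open>y\<close>; the sets below are the traces of clopen sets of
  the resulting space.\<close>

definition clopen :: "('w \<times> 'w \<times> nat) set \<Rightarrow> bool" where
  "clopen c \<longleftrightarrow> (\<exists>N. \<forall>x y. (x, y) \<in> E \<longrightarrow> (\<forall>m\<ge>N. \<forall>n\<ge>N. (x, y, m) \<in> c \<longleftrightarrow> (y, x, n) \<in> c))"

primrec den :: "set_term \<Rightarrow> ('w \<times> 'w \<times> nat) set" where
  "den (Gen k) = cyl (g k)"
| "den (Level k) = {(x, y, n) \<in> points. k < n}"
| "den (SCompl t) = points - den t"
| "den (SInter s t) = den s \<inter> den t"
| "den (SPre t) = pre (den t)"
| "den (SSwap t) = swap_set (den t)"

definition sets :: "('w \<times> 'w \<times> nat) set set" where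
  "sets = range den"

definition alg :: "('w \<times> 'w \<times> nat) set modal_contact" where
  "alg = \<lparr>carrier = sets, meet = (\<inter>), join = (\<union>), compl = (\<lambda>a. points - a), zero = {}, one = points,
    prec = (\<lambda>a b. \<exists>c\<in>sets. clopen c \<and> a \<subseteq> c \<and> c \<subseteq> b), dia = pre\<rparr>"

lemma alg_simps:
  "carrier alg = sets" "meet alg = (\<inter>)" "join alg = (\<union>)" "compl alg = (\<lambda>a. points - a)"
  "zero alg = {}" "one alg = points" "dia alg = pre"
  "prec alg = (\<lambda>a b. \<exists>c\<in>sets. clopen c \<and> a \<subseteq> c \<and> c \<subseteq> b)"
  by (simp_all add: alg_def)

lemma alg_le: "a \<sqsubseteq>\<^bsub>alg\<^esub> b \<longleftrightarrow> a \<subseteq> b"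
  by (auto simp: le_def alg_simps)

section \<open>Closure properties of the carrier\<close>

lemma countable_sets: "countable sets"
  by (simp add: sets_def)

lemma den_subset: "den t \<subseteq> points"
  by (induction t) (auto simp: cyl_def pre_def swap_set_def)

lemma sets_subset: "a \<in> sets \<Longrightarrow> a \<subseteq> points"
  using den_subset by (auto simp: sets_def)

lemma sets_compl: "a \<in> sets \<Longrightarrow> points - a \<in> sets"
  by (auto simp: sets_def simp flip: den.simps(3))

lemma sets_inter: "a \<in> sets \<Longrightarrow> b \<in> sets \<Longrightarrow> a \<inter> b \<in> sets"
  by (auto simp: sets_def simp flip: den.simps(4))

lemma sets_pre: "a \<in> sets \<Longrightarrow> pre a \<in> sets"
  by (auto simp: sets_def simp flip: den.simps(5))

lemma sets_swap: "a \<in> sets \<Longrightarrow> swap_set a \<in> sets"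
  by (auto simp: sets_def simp flip: den.simps(6))

lemma sets_gen: "cyl (g k) \<in> sets"
  by (auto simp: sets_def simp flip: den.simps(1))

lemma sets_level: "{(x, y, n) \<in> points. k < n} \<in> sets"
  by (auto simp: sets_def simp flip: den.simps(2))

lemma sets_union:
  assumes "a \<in> sets" "b \<in> sets"
  shows "a \<union> b \<in> sets"
proof -
  have "a \<union> b = points - ((points - a) \<inter> (points - b))"
    using assms sets_subset by auto
  then show ?thesis
    using assms by (simp only: sets_compl sets_inter)
qed

lemma sets_empty: "{} \<in> sets"
  using sets_inter[OF sets_gen sets_compl[OF sets_gen], of 0 0] by auto

lemma sets_points: "points \<in> sets"
  using sets_compl[OF sets_empty] by simp

section \<open>Clopen sets\<close>

lemma clopen_compl: "clopen c \<Longrightarrow> clopen (points - c)"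
  unfolding clopen_def points_def using E_sym by fastforce

lemma clopen_inter:
  assumes "clopen c" "clopen d"
  shows "clopen (c \<inter> d)"
proof -
  obtain M N where
    "\<forall>x y. (x, y) \<in> E \<longrightarrow> (\<forall>m\<ge>M. \<forall>n\<ge>M. (x, y, m) \<in> c \<longleftrightarrow> (y, x, n) \<in> c)"
    "\<forall>x y. (x, y) \<in> E \<longrightarrow> (\<forall>m\<ge>N. \<forall>n\<ge>N. (x, y, m) \<in> d \<longleftrightarrow> (y, x, n) \<in> d)"
    using assms by (auto simp: clopen_def)
  then show ?thesis
    unfolding clopen_def by (intro exI[of _ "max M N"]) (simp, blast)
qed

lemma clopen_union:
  assumes "clopen c" "clopen d"
  shows "clopen (c \<union> d)"
proof -
  obtain M N where
    "\<forall>x y. (x, y) \<in> E \<longrightarrow> (\<forall>m\<ge>M. \<forall>n\<ge>M. (x, y, m) \<in> c \<longleftrightarrow> (y, x, n) \<in> c)"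
    "\<forall>x y. (x, y) \<in> E \<longrightarrow> (\<forall>m\<ge>N. \<forall>n\<ge>N. (x, y, m) \<in> d \<longleftrightarrow> (y, x, n) \<in> d)"
    using assms by (auto simp: clopen_def)
  then show ?thesis
    unfolding clopen_def by (intro exI[of _ "max M N"]) (simp, blast)
qed

text \<open>Swapping both the point and its successor preserves \<open>S\<close> on each endpoint,
  and \<open>pre\<close> preserves levels, so the threshold of \<open>c\<close> also works for
  \<open>pre c\<close>.\<close>

lemma clopen_pre:
  assumes "clopen c"
  shows "clopen (pre c)"
proof -
  obtain N where N: "\<forall>x y. (x, y) \<in> E \<longrightarrow> (\<forall>m\<ge>N. \<forall>n\<ge>N. (x, y, m) \<in> c \<longleftrightarrow> (y, x, n) \<in> c)"
    using assms by (auto simp: clopen_def)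
  have *: "(y, x, n) \<in> pre c" if "(x, y, m) \<in> pre c" "m \<ge> N" "n \<ge> N" for x y m n
  proof -
    obtain x' y' where "(x, y) \<in> E" "S x x'" "S y y'" "(x', y') \<in> E" "(x', y', m) \<in> c"
      using \<open>(x, y, m) \<in> pre c\<close> by (auto simp: pre_def points_def)
    moreover from this have "(y', x', n) \<in> c"
      using N that by blast
    ultimately show ?thesis
      using E_sym by (auto simp: pre_def points_def)
  qed
  show ?thesis
    unfolding clopen_def using * by blast
qed

lemma clopen_empty: "clopen {}" and clopen_points: "clopen points"
  using E_sym by (auto simp: clopen_def points_def)

text \<open>From level \<open>Suc k\<close> on, the first one satisfying the strict test
  \<open>k < n\<close>, every point belongs to the set.\<close>

lemma clopen_union_level: "a \<subseteq> points \<Longrightarrow> clopen (a \<union> {(x, y, n) \<in> points. k < n})"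
  unfolding clopen_def using E_sym by (intro exI[of _ "Suc k"]) (auto simp: points_def)

lemma clopen_minus_level: "a \<subseteq> points \<Longrightarrow> clopen (a \<inter> (points - {(x, y, n) \<in> points. k < n}))"
  unfolding clopen_def by (intro exI[of _ "Suc k"]) (auto simp: points_def)

lemma pre_union: "pre (a \<union> b) = pre a \<union> pre b"
  by (auto simp: pre_def)

lemma pre_mono: "a \<subseteq> b \<Longrightarrow> pre a \<subseteq> pre b"
  by (auto simp: pre_def)

lemma zerodim_alg: "zerodim_uc_modal_compingent_algebra alg"
proof unfold_locales
  fix a assume a: "a \<in> carrier alg" "a \<noteq> \<zero>\<^bsub>alg\<^esub>"
  then obtain x y n where p: "(x, y, n) \<in> a" "(x, y, n) \<in> points"
    using sets_subset by (fastforce simp: alg_simps)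
  \<comment> \<open>Cutting \<open>a\<close> off above the level of one of its points keeps that
    point and makes the set clopen.\<close>
  define b where "b = a \<inter> (points - {(x, y, m) \<in> points. n < m})"
  have "b \<noteq> {}" "b \<subseteq> a"
    using p by (auto simp: b_def)
  moreover have "b \<in> sets"
    using a by (simp add: b_def alg_simps sets_inter sets_compl sets_level)
  moreover have "clopen b"
    using a sets_subset by (simp add: b_def alg_simps clopen_minus_level)
  ultimately show "\<exists>b\<in>carrier alg. b \<noteq> \<zero>\<^bsub>alg\<^esub> \<and> b \<prec>\<^bsub>alg\<^esub> a"
    unfolding alg_simps by blast
next
  fix a1 a2 b1 b2 assume "a1 \<prec>\<^bsub>alg\<^esub> b1" "a2 \<prec>\<^bsub>alg\<^esub> b2"
  then obtain c1 c2 where c: "c1 \<in> sets" "c2 \<in> sets" "clopen c1" "clopen c2"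
    "a1 \<subseteq> c1" "a2 \<subseteq> c2" "c1 \<subseteq> b1" "c2 \<subseteq> b2"
    by (auto simp: alg_simps)
  have "clopen (pre (c1 \<union> c2))" "pre (c1 \<union> c2) \<in> sets"
    using c by (auto simp: clopen_pre clopen_union sets_pre sets_union)
  moreover have "pre (a1 \<union> a2) \<subseteq> pre (c1 \<union> c2)" "pre (c1 \<union> c2) \<subseteq> pre b1 \<union> pre b2"
    using c unfolding pre_union[symmetric] by (intro pre_mono; auto)+
  ultimately show "\<diamond>\<^bsub>alg\<^esub> (a1 \<squnion>\<^bsub>alg\<^esub> a2) \<prec>\<^bsub>alg\<^esub> (\<diamond>\<^bsub>alg\<^esub> b1) \<squnion>\<^bsub>alg\<^esub> (\<diamond>\<^bsub>alg\<^esub> b2)"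
    unfolding alg_simps by blast
next
  fix a assume a: "a \<in> carrier alg"
  \<comment> \<open>A point of level \<open>n\<close> only sees level \<open>n\<close>, so \<open>pre\<close> does not notice that all higher levels
    have been added to \<open>a\<close>, which makes the set clopen.\<close>
  have "l \<subseteq> pre a" if l: "l \<in> sets"
    "\<And>b. \<lbrakk>b \<in> sets; a \<prec>\<^bsub>alg\<^esub> b\<rbrakk> \<Longrightarrow> l \<subseteq> pre b" for l
  proof
    fix p assume p: "p \<in> l"
    obtain x y n where xyn: "p = (x, y, n)"
      by (cases p)
    define c where "c = a \<union> {(x, y, m) \<in> points. n < m}"
    have c: "c \<in> sets" "clopen c" "a \<subseteq> c"
      using a sets_subset by (auto simp: c_def alg_simps sets_union sets_level clopen_union_level)
    then have "a \<prec>\<^bsub>alg\<^esub> c"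
      unfolding alg_simps by blast
    then have "p \<in> pre c"
      using l(2) c(1) p by blast
    then show "p \<in> pre a"
      by (auto simp: xyn pre_def c_def)
  qed
  moreover have "pre a \<subseteq> pre b" if "a \<prec>\<^bsub>alg\<^esub> b" for b
    using that by (intro pre_mono) (auto simp: alg_simps)
  ultimately show "is_inf alg {\<diamond>\<^bsub>alg\<^esub> b |b. b \<in> carrier alg \<and> a \<prec>\<^bsub>alg\<^esub> b} (\<diamond>\<^bsub>alg\<^esub> a)"
    using a unfolding is_inf_def alg_le by (auto simp: alg_simps(1,7) sets_pre; blast)
next
  fix a b c assume "a \<prec>\<^bsub>alg\<^esub> b" "a \<prec>\<^bsub>alg\<^esub> c"
  then obtain d e where "d \<in> sets" "e \<in> sets" "clopen d" "clopen e"
    "a \<subseteq> d" "d \<subseteq> b" "a \<subseteq> e" "e \<subseteq> c"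
    by (auto simp: alg_simps)
  then have "d \<inter> e \<in> sets" "clopen (d \<inter> e)" "a \<subseteq> d \<inter> e" "d \<inter> e \<subseteq> b \<inter> c"
    by (auto simp: sets_inter clopen_inter)
  then show "a \<prec>\<^bsub>alg\<^esub> b \<sqinter>\<^bsub>alg\<^esub> c"
    unfolding alg_simps by blast
next
  fix a b c assume "a \<prec>\<^bsub>alg\<^esub> c" "b \<prec>\<^bsub>alg\<^esub> c"
  then obtain d e where "d \<in> sets" "e \<in> sets" "clopen d" "clopen e"
    "a \<subseteq> d" "d \<subseteq> c" "b \<subseteq> e" "e \<subseteq> c"
    by (auto simp: alg_simps)
  then have "d \<union> e \<in> sets" "clopen (d \<union> e)" "a \<union> b \<subseteq> d \<union> e" "d \<union> e \<subseteq> c"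
    by (auto simp: sets_union clopen_union)
  then show "a \<squnion>\<^bsub>alg\<^esub> b \<prec>\<^bsub>alg\<^esub> c"
    unfolding alg_simps by blast
next
  fix a b assume "a \<prec>\<^bsub>alg\<^esub> b"
  then obtain c where "c \<in> sets" "clopen c" "a \<subseteq> c" "c \<subseteq> b"
    by (auto simp: alg_simps)
  then have "points - c \<in> sets" "clopen (points - c)"
    "points - b \<subseteq> points - c" "points - c \<subseteq> points - a"
    by (auto simp: sets_compl clopen_compl)
  then show "\<sim>\<^bsub>alg\<^esub> b \<prec>\<^bsub>alg\<^esub> \<sim>\<^bsub>alg\<^esub> a"
    unfolding alg_simps by blast
next
  fix a b c d assume "a \<sqsubseteq>\<^bsub>alg\<^esub> b" "b \<prec>\<^bsub>alg\<^esub> c" "c \<sqsubseteq>\<^bsub>alg\<^esub> d"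
  then show "a \<prec>\<^bsub>alg\<^esub> d"
    unfolding alg_le unfolding alg_simps by blast
next
  fix a b assume "a \<prec>\<^bsub>alg\<^esub> b"
  \<comment> \<open>A clopen member of the carrier precedes itself, so the set witnessing
    \<open>a \<prec> b\<close> serves as both interpolants.\<close>
  then show "a \<sqsubseteq>\<^bsub>alg\<^esub> b" "\<exists>c\<in>carrier alg. a \<prec>\<^bsub>alg\<^esub> c \<and> c \<prec>\<^bsub>alg\<^esub> b"
    "\<exists>c\<in>carrier alg. c \<prec>\<^bsub>alg\<^esub> c \<and> a \<prec>\<^bsub>alg\<^esub> c \<and> c \<prec>\<^bsub>alg\<^esub> b"
    unfolding alg_le unfolding alg_simps by blast+
next
  show "\<zero>\<^bsub>alg\<^esub> \<prec>\<^bsub>alg\<^esub> \<zero>\<^bsub>alg\<^esub>" "\<one>\<^bsub>alg\<^esub> \<prec>\<^bsub>alg\<^esub> \<one>\<^bsub>alg\<^esub>"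
    unfolding alg_simps using sets_empty sets_points clopen_empty clopen_points by blast+
next
  show "\<diamond>\<^bsub>alg\<^esub> \<zero>\<^bsub>alg\<^esub> = \<zero>\<^bsub>alg\<^esub>"
    by (simp add: alg_simps pre_def)
qed (use sets_subset in \<open>auto simp: alg_simps sets_inter sets_union sets_compl sets_empty sets_points sets_pre\<close>)

text \<open>Each edge carries points of every level, so an intermediate clopen set must at a high
  level contain, with a point over \<open>(x, y)\<close>, the one over
  \<open>(y, x)\<close>.\<close>

lemma cyl_prec_iff:
  assumes "cyl a \<in> sets"
  shows "cyl a \<prec>\<^bsub>alg\<^esub> cyl b \<longleftrightarrow> (\<forall>(x, y)\<in>E. x \<in> a \<longrightarrow> y \<in> b)"
proof
  assume "cyl a \<prec>\<^bsub>alg\<^esub> cyl b"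
  then obtain c N where c: "cyl a \<subseteq> c" "c \<subseteq> cyl b"
    and N: "\<forall>x y. (x, y) \<in> E \<longrightarrow> (\<forall>m\<ge>N. \<forall>n\<ge>N. (x, y, m) \<in> c \<longleftrightarrow> (y, x, n) \<in> c)"
    by (auto simp: alg_simps clopen_def)
  show "\<forall>(x, y)\<in>E. x \<in> a \<longrightarrow> y \<in> b"
  proof safe
    fix x y assume xy: "(x, y) \<in> E" "x \<in> a"
    then have "(x, y, N) \<in> c"
      using c by (auto simp: cyl_def points_def)
    then have "(y, x, N) \<in> c"
      using N xy by blast
    then show "y \<in> b"
      using c by (auto simp: cyl_def)
  qed
next
  assume ab: "\<forall>(x, y)\<in>E. x \<in> a \<longrightarrow> y \<in> b"
  \<comment> \<open>The symmetrised cylinder. That \<open>cyl a\<close> lies in \<open>cyl b\<close>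
    uses the loops from \<open>E_refl\<close>; the swapped part uses the edges themselves.\<close>
  define c where "c = cyl a \<union> swap_set (cyl a)"
  have "c \<in> sets"
    using assms by (simp add: c_def sets_union sets_swap)
  moreover have "clopen c"
    using E_sym by (auto simp: c_def clopen_def cyl_def swap_set_def points_def)
  moreover have "cyl a \<subseteq> c" "c \<subseteq> cyl b"
    using ab E_sym E_refl by (fastforce simp: c_def cyl_def swap_set_def points_def)+
  ultimately show "cyl a \<prec>\<^bsub>alg\<^esub> cyl b"
    unfolding alg_simps by blast
qed

end

section \<open>Transport along an injection\<close>

text \<open>Arguments are pulled back by the inverse of \<open>f\<close> on the carrier, so the
  operations are meaningful only on its image.\<close>

definition transport :: "('a \<Rightarrow> 'b) \<Rightarrow> ('a, 'm) modal_contact_scheme \<Rightarrow> 'b modal_contact" where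
  "transport f B = (let h = inv_into (carrier B) f in
    \<lparr>carrier = f ` carrier B, meet = (\<lambda>a b. f (h a \<sqinter>\<^bsub>B\<^esub> h b)), join = (\<lambda>a b. f (h a \<squnion>\<^bsub>B\<^esub> h b)),
     compl = (\<lambda>a. f (\<sim>\<^bsub>B\<^esub> h a)), zero = f \<zero>\<^bsub>B\<^esub>, one = f \<one>\<^bsub>B\<^esub>,
     prec = (\<lambda>a b. h a \<prec>\<^bsub>B\<^esub> h b), dia = (\<lambda>a. f (\<diamond>\<^bsub>B\<^esub> h a))\<rparr>)"

context
  fixes B :: "('a, 'm) modal_contact_scheme" and f :: "'a \<Rightarrow> 'b"
  assumes alg: "zerodim_uc_modal_compingent_algebra B" and inj: "inj_on f (carrier B)"
begin

interpretation zerodim_uc_modal_compingent_algebra B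
  by (rule alg)

lemma transport_simps:
  "carrier (transport f B) = f ` carrier B"
  "zero (transport f B) = f \<zero>\<^bsub>B\<^esub>"
  "one (transport f B) = f \<one>\<^bsub>B\<^esub>"
  "a \<in> carrier B \<Longrightarrow> compl (transport f B) (f a) = f (\<sim>\<^bsub>B\<^esub> a)"
  "a \<in> carrier B \<Longrightarrow> dia (transport f B) (f a) = f (\<diamond>\<^bsub>B\<^esub> a)"
  "\<lbrakk>a \<in> carrier B; b \<in> carrier B\<rbrakk> \<Longrightarrow> meet (transport f B) (f a) (f b) = f (a \<sqinter>\<^bsub>B\<^esub> b)"
  "\<lbrakk>a \<in> carrier B; b \<in> carrier B\<rbrakk> \<Longrightarrow> join (transport f B) (f a) (f b) = f (a \<squnion>\<^bsub>B\<^esub> b)"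
  "\<lbrakk>a \<in> carrier B; b \<in> carrier B\<rbrakk> \<Longrightarrow> prec (transport f B) (f a) (f b) \<longleftrightarrow> a \<prec>\<^bsub>B\<^esub> b"
  using inj by (simp_all add: transport_def Let_def)

lemma transport_le:
  "\<lbrakk>a \<in> carrier B; b \<in> carrier B\<rbrakk> \<Longrightarrow> le (transport f B) (f a) (f b) \<longleftrightarrow> a \<sqsubseteq>\<^bsub>B\<^esub> b"
  using inj by (auto simp: le_def transport_simps meet_closed dest: inj_onD)

lemma transport_inf:
  assumes "S \<subseteq> carrier B" "is_inf B S m"
  shows "is_inf (transport f B) (f ` S) (f m)"
  using assms transport_le unfolding is_inf_def
  by (auto simp: transport_simps subset_iff)

lemma zerodim_transport: "zerodim_uc_modal_compingent_algebra (transport f B)"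
proof unfold_locales
  fix a assume "a \<in> carrier (transport f B)"
  then obtain a' where a: "a' \<in> carrier B" "a = f a'"
    by (auto simp: transport_simps)
  have "f ` {\<diamond>\<^bsub>B\<^esub> b |b. b \<in> carrier B \<and> a' \<prec>\<^bsub>B\<^esub> b} =
      {dia (transport f B) b |b. b \<in> carrier (transport f B) \<and> prec (transport f B) a b}"
    using a by (force simp: transport_simps)
  then show "is_inf (transport f B)
      {dia (transport f B) b |b. b \<in> carrier (transport f B) \<and> prec (transport f B) a b}
      (dia (transport f B) a)"
    using transport_inf[OF _ upper_continuous[OF a(1)]] a dia_closed
    by (auto simp: transport_simps)
next
  fix a b c d
  assume "a \<in> carrier (transport f B)" "b \<in> carrier (transport f B)"
    "c \<in> carrier (transport f B)" "d \<in> carrier (transport f B)"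
    "le (transport f B) a b" "prec (transport f B) b c" "le (transport f B) c d"
  then show "prec (transport f B) a d"
    using prec_mono by (auto simp: transport_simps transport_le)
next
  fix a b
  assume "a \<in> carrier (transport f B)" "b \<in> carrier (transport f B)" "prec (transport f B) a b"
  then show "le (transport f B) a b" "prec (transport f B) (compl (transport f B) b) (compl (transport f B) a)"
    "\<exists>c\<in>carrier (transport f B). prec (transport f B) a c \<and> prec (transport f B) c b"
    "\<exists>c\<in>carrier (transport f B). prec (transport f B) c c \<and> prec (transport f B) a c \<and>
      prec (transport f B) c b"
    using prec_le prec_compl prec_interpolate zerodimensional
    by (auto simp: transport_simps transport_le compl_closed; blast)+
next
  fix a assume "a \<in> carrier (transport f B)" "a \<noteq> zero (transport f B)"
  then obtain a' where a: "a' \<in> carrier B" "a = f a'" "a' \<noteq> \<zero>\<^bsub>B\<^esub>"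
    by (auto simp: transport_simps)
  obtain b where "b \<in> carrier B" "b \<noteq> \<zero>\<^bsub>B\<^esub>" "b \<prec>\<^bsub>B\<^esub> a'"
    using prec_nonzero a by blast
  then show "\<exists>b\<in>carrier (transport f B). b \<noteq> zero (transport f B) \<and> prec (transport f B) b a"
    using a inj zero_closed by (intro bexI[of _ "f b"]) (auto simp: transport_simps dest: inj_onD)
qed (auto simp: transport_simps meet_closed join_closed compl_closed zero_closed one_closed dia_closed
    meet_one join_zero meet_compl join_compl prec_zero prec_one prec_meet prec_join dia_zero
    de_Vries_additive intro!: arg_cong[where f = f] meet_assoc join_assoc meet_comm join_comm
    meet_join_distrib join_meet_distrib)

text \<open>Membership in the carrier is proved in the same induction because the laws in
  \<open>transport_simps\<close> hold only there.\<close>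

lemma ext_transport:
  assumes "\<forall>n. v n \<in> carrier B"
  shows "ext (transport f B) (f \<circ> v) \<phi> = f (ext B v \<phi>) \<and> ext B v \<phi> \<in> carrier B"
  using assms
  by (induction \<phi>) (auto simp: transport_simps meet_closed join_closed compl_closed zero_closed
      one_closed dia_closed)

lemma valid_transportD:
  assumes "valid_in (transport f B) \<phi>"
  shows "valid_in B \<phi>"
  unfolding valid_in_def
proof safe
  fix v :: "nat \<Rightarrow> 'a" assume v: "\<forall>n. v n \<in> carrier B"
  then have "ext (transport f B) (f \<circ> v) \<phi> = f \<one>\<^bsub>B\<^esub>"
    using assms by (auto simp: valid_in_def transport_simps)
  then show "ext B v \<phi> = \<one>\<^bsub>B\<^esub>"
    using ext_transport[OF v, of \<phi>] inj one_closed by (auto dest: inj_onD)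
qed

end

section \<open>Completeness\<close>

context canonical
begin

sublocale frame edges "\<lambda>x y. maximal y \<and> succ x y" "\<lambda>k. {x. Var k \<in> x}"
proof
  show "(y, x) \<in> edges" if "(x, y) \<in> edges" for x y
    using that by (rule edge_sym)
  show "(x, x) \<in> edges" if "(x, y) \<in> edges" for x y
    using that by (intro edge_refl) (simp add: edges_def)
qed

text \<open>This is the truth lemma. Strict formulas combine \<open>cyl_prec_iff\<close> with
  \<open>prec_fm_iff_edges\<close>; for boxes, \<open>pre\<close> moves both endpoints of an edge at
  once, which \<open>succ_edge_commute\<close> makes possible.\<close>

lemma ext_canonical:
  "ext alg (\<lambda>k. cyl {x. Var k \<in> x}) \<phi> = cyl {x. \<phi> \<in> x} \<and> cyl {x. \<phi> \<in> x} \<in> sets"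
proof -
  have world: "x \<in> worlds" "maximal x" if "(x, y, n) \<in> points" for x y n
  proof -
    have "(x, y) \<in> edges"
      using that by (simp add: points_def)
    then show "x \<in> worlds" "maximal x"
      by (auto simp: edges_def worlds_def)
  qed
  let ?e = "ext alg (\<lambda>k. cyl {x. Var k \<in> x})"
  have car: "?e \<psi> \<in> sets" for \<psi>
    by (induction \<psi>) (auto simp: alg_simps sets_gen sets_points sets_empty sets_compl sets_inter
        sets_union sets_pre)
  have "?e \<phi> = cyl {x. \<phi> \<in> x}"
  proof (induction \<phi>)
    case (Strict \<phi> \<psi>)
    then have "cyl {x. \<phi> \<in> x} \<in> sets"
      using car[of \<phi>] by simp
    then have "cyl {x. \<phi> \<in> x} \<prec>\<^bsub>alg\<^esub> cyl {x. \<psi> \<in> x} \<longleftrightarrow> \<phi> \<lless> \<psi>"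
      using prec_fm_iff_edges[of \<phi> \<psi>] by (simp add: cyl_prec_iff)
    then have "?e (\<phi> \<leadsto> \<psi>) = (if \<phi> \<lless> \<psi> then points else {})"
      using Strict by (simp add: alg_simps(5,6))
    also have "\<dots> = cyl {x. (\<phi> \<leadsto> \<psi>) \<in> x}"
      using world(1) strict_mem_iff[of _ \<phi> \<psi>] by (auto simp: cyl_def)
    finally show ?case .
  next
    case (Box \<phi>)
    have "(x, y, n) \<in> points - pre (points - cyl {x. \<phi> \<in> x}) \<longleftrightarrow> (x, y, n) \<in> cyl {x. \<box>\<phi> \<in> x}" for x y n
    proof (cases "(x, y, n) \<in> points")
      case True
      then have xy: "(x, y) \<in> edges" "x \<in> worlds"
        using world by (auto simp: points_def)
      have "(x, y, n) \<in> points - pre (points - cyl {x. \<phi> \<in> x}) \<longleftrightarrow>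
          (\<forall>x' y'. maximal x' \<and> succ x x' \<longrightarrow> maximal y' \<and> succ y y' \<longrightarrow> (x', y') \<in> edges \<longrightarrow> \<phi> \<in> x')"
        using True by (auto simp: pre_def cyl_def points_def)
      also have "\<dots> \<longleftrightarrow> (\<forall>x'. maximal x' \<longrightarrow> succ x x' \<longrightarrow> \<phi> \<in> x')"
        using succ_edge_commute[OF xy(1)] by metis
      finally show ?thesis
        using True box_mem_iff[OF xy(2)] by (simp add: cyl_def)
    next
      case False
      then show ?thesis
        by (auto simp: cyl_def)
    qed
    then have "points - pre (points - cyl {x. \<phi> \<in> x}) = cyl {x. \<box>\<phi> \<in> x}"
      by (auto simp: set_eq_iff)
    then show ?case
      using Box by (simp add: alg_simps)
  qed (auto simp: alg_simps cyl_def maximal_simps dest: world(2))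
  then show ?thesis
    using car[of \<phi>] by simp
qed

text \<open>By \<open>A4\<close>, \<open>\<Gamma>\<close> is itself a world, and the formula fails
  at the level 0 point over its loop.\<close>

lemma canonical_refutes:
  assumes "\<phi> \<notin> \<Gamma>"
  shows "\<not> valid_in alg \<phi>"
proof
  assume "valid_in alg \<phi>"
  then have "cyl {x. \<phi> \<in> x} = points"
    using ext_canonical[of \<phi>] sets_gen by (auto simp: valid_in_def alg_simps)
  moreover have "\<theta> \<in> \<Gamma>" if "\<^bold>\<top> \<lless> \<theta>" for \<theta>
    using that maximal_theorem[OF max MS2IC.A4[of "\<^bold>\<top>" \<theta>]] max by (simp add: maximal_simps)
  then have "\<Gamma> \<in> worlds"
    using max by (auto simp: worlds_def)
  then have "(\<Gamma>, \<Gamma>, 0) \<in> points"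
    by (simp add: points_def edge_refl)
  ultimately have "(\<Gamma>, \<Gamma>, 0) \<in> cyl {x. \<phi> \<in> x}"
    by simp
  then show False
    using assms by (simp add: cyl_def)
qed

end

lemma completeness:
  assumes "infinite (UNIV :: 'a set)" "\<not> MS2IC \<phi>"
  shows "\<exists>B :: 'a modal_contact. zerodim_uc_modal_compingent_algebra B \<and> \<not> valid_in B \<phi>"
proof -
  have "mtheory {\<theta>. MS2IC \<theta>}"
    using MS2IC.MP by (auto simp: mtheory_def)
  then obtain \<Gamma> where \<Gamma>: "maximal \<Gamma>" "\<phi> \<notin> \<Gamma>"
    using Lindenbaum[of "{\<theta>. MS2IC \<theta>}" \<phi>] assms(2) by blast
  interpret canonical \<Gamma>
    by unfold_locales (rule \<Gamma>)
  obtain e :: "nat \<Rightarrow> 'a" where e: "inj e"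
    using infinite_countable_subset[OF assms(1)] by blast
  \<comment> \<open>The countable carrier is numbered, and the numbers are placed in the given
    infinite type.\<close>
  define f where "f = e \<circ> to_nat_on sets"
  have f: "inj_on f (carrier alg)"
    unfolding f_def alg_simps
    using e inj_on_to_nat_on[OF countable_sets] by (blast intro: comp_inj_on inj_on_subset)
  have "\<not> valid_in (transport f alg) \<phi>"
    using valid_transportD[OF zerodim_alg f] canonical_refutes[OF \<Gamma>(2)] by blast
  then show ?thesis
    using zerodim_transport[OF zerodim_alg f] by blast
qed

theorem theorem4p17:
  fixes \<phi> :: fm
  assumes "infinite (UNIV :: 'a set)"
  shows "MS2IC \<phi> \<longleftrightarrow>
    (\<forall>B :: 'a modal_contact. zerodim_uc_modal_compingent_algebra B \<longrightarrow> valid_in B \<phi>)"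
proof
  assume "MS2IC \<phi>"
  then show "\<forall>B :: 'a modal_contact. zerodim_uc_modal_compingent_algebra B \<longrightarrow> valid_in B \<phi>"
    using zerodim_uc_modal_compingent_algebra.soundness by (auto simp: valid_in_def)
next
  assume "\<forall>B :: 'a modal_contact. zerodim_uc_modal_compingent_algebra B \<longrightarrow> valid_in B \<phi>"
  then show "MS2IC \<phi>"
    using completeness[OF assms] by blast
qed

end
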